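(* Let $P$ be a simple $3$-dimensional polytope. For each vertex $v$ of $P$ let $\boldsymbol{\ell}(v)\in\mathbb{Z}^3$ be the vector of the numbers of edges of the three $2$-faces incident to $v$, listed in non-increasing order. Assume: (i) $\boldsymbol{\ell}(v)\in\{3,4,5\}^3$ for every vertex $v$; (ii) no $\boldsymbol{\ell}(v)$ equals $(5,5,5)$. Fix a vertex $v_0$ and assume further: (iii) at most one entry of $\boldsymbol{\ell}(v_0)$ equals $5$; (iv) for each neighbor $u$ of $v_0$, the $2$-face incident to $u$ that is not incident to $v_0$ has at most four edges; (v) no vertex $w$ lying on one of the three $2$-faces incident to $v_0$ has $\boldsymbol{\ell}(w)=(5,5,4)$. Then the $\Delta$-expansion of $P$ at $v_0$ is resistance positive.
   Context: A $3$-polytope is simple if its graph is $3$-regular. The $\Delta$-expansion of a simple $3$-polytope $P$ at a vertex $v_0$ (with neighbors $v_1,v_2,v_3$) is the simple $3$-polytope obtained by truncating $v_0$: combinatorially, $v_0$ is replaced by a new triangular $2$-face with vertices $u_1,u_2,u_3$, where $u_i$ is adjacent to $v_i$ and to the other two $u_j$; each of the three $2$-faces formerly incident to $v_0$ gains one edge, and all other faces are unchanged. For a finite graph with Laplacian $\mathbf{L}=\mathbf{D}-\mathbf{A}$ and Moore--Penrose pseudoinverse $\mathbf{L}^\dagger$, the effective resistance is $r_{uv}=(\mathbf{1}_u-\mathbf{1}_v)^\top\mathbf{L}^\dagger(\mathbf{1}_u-\mathbf{1}_v)$ and the resistance curvature is $\kappa(v)=1-\frac12\sum_{u\sim v}r_{uv}$.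 A polytope is resistance positive if $\kappa(v)>0$ at every vertex of its graph. *)

theory Defs
  imports "HOL-Analysis.Analysis" "HOL-Library.Multiset"
begin

text \<open>Effective resistance and resistance curvature of a finite simple graph, given by a vertex set
  \<open>V\<close> and a symmetric irreflexive adjacency relation \<open>adj\<close>.
  Real matrices with rows and columns indexed by \<open>V\<close> are functions \<open>'a \<Rightarrow> 'a \<Rightarrow> real\<close>,
  of which only the entries in \<open>V \<times> V\<close> matter.\<close>

definition mat_mul :: "'a set \<Rightarrow> ('a \<Rightarrow> 'a \<Rightarrow> real) \<Rightarrow> ('a \<Rightarrow> 'a \<Rightarrow> real) \<Rightarrow> 'a \<Rightarrow> 'a \<Rightarrow> real" where
  "mat_mul V A B = (\<lambda>x y. \<Sum>z\<in>V. A x z * B z y)"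

definition mat_eq :: "'a set \<Rightarrow> ('a \<Rightarrow> 'a \<Rightarrow> real) \<Rightarrow> ('a \<Rightarrow> 'a \<Rightarrow> real) \<Rightarrow> bool" where
  "mat_eq V A B \<longleftrightarrow> (\<forall>x\<in>V. \<forall>y\<in>V. A x y = B x y)"

definition mat_sym :: "'a set \<Rightarrow> ('a \<Rightarrow> 'a \<Rightarrow> real) \<Rightarrow> bool" where
  "mat_sym V A \<longleftrightarrow> mat_eq V A (\<lambda>x y. A y x)"

text \<open>The four Penrose conditions for \<open>X\<close>; the last conjunct makes \<open>X\<close> unique as a function.\<close>

definition is_pseudoinverse :: "'a set \<Rightarrow> ('a \<Rightarrow> 'a \<Rightarrow> real) \<Rightarrow> ('a \<Rightarrow> 'a \<Rightarrow> real) \<Rightarrow> bool" where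
  "is_pseudoinverse V A X \<longleftrightarrow>
     mat_eq V (mat_mul V (mat_mul V A X) A) A \<and>
     mat_eq V (mat_mul V (mat_mul V X A) X) X \<and>
     mat_sym V (mat_mul V A X) \<and>
     mat_sym V (mat_mul V X A) \<and>
     (\<forall>x y. x \<notin> V \<or> y \<notin> V \<longrightarrow> X x y = 0)"

definition pseudoinverse :: "'a set \<Rightarrow> ('a \<Rightarrow> 'a \<Rightarrow> real) \<Rightarrow> 'a \<Rightarrow> 'a \<Rightarrow> real" where
  "pseudoinverse V A = (THE X. is_pseudoinverse V A X)"

definition degree_matrix :: "'a set \<Rightarrow> ('a \<Rightarrow> 'a \<Rightarrow> bool) \<Rightarrow> 'a \<Rightarrow> 'a \<Rightarrow> real" where
  "degree_matrix V adj = (\<lambda>x y. if x = y then real (card {z \<in> V. adj x z}) else 0)"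

definition adjacency_matrix :: "('a \<Rightarrow> 'a \<Rightarrow> bool) \<Rightarrow> 'a \<Rightarrow> 'a \<Rightarrow> real" where
  "adjacency_matrix adj = (\<lambda>x y. if adj x y then 1 else 0)"

definition laplacian :: "'a set \<Rightarrow> ('a \<Rightarrow> 'a \<Rightarrow> bool) \<Rightarrow> 'a \<Rightarrow> 'a \<Rightarrow> real" where
  "laplacian V adj = (\<lambda>x y. degree_matrix V adj x y - adjacency_matrix adj x y)"

definition effective_resistance :: "'a set \<Rightarrow> ('a \<Rightarrow> 'a \<Rightarrow> bool) \<Rightarrow> 'a \<Rightarrow> 'a \<Rightarrow> real" where
  "effective_resistance V adj u v =
     (\<Sum>x\<in>V. \<Sum>y\<in>V. (indicator {u} x - indicator {v} x) * pseudoinverse V (laplacian V adj) x y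
                          * (indicator {u} y - indicator {v} y))"

definition resistance_curvature :: "'a set \<Rightarrow> ('a \<Rightarrow> 'a \<Rightarrow> bool) \<Rightarrow> 'a \<Rightarrow> real" where
  "resistance_curvature V adj v = 1 - (1/2) * (\<Sum>u\<in>{u \<in> V. adj u v}. effective_resistance V adj u v)"

text \<open>The graph of a polytope. If \<open>closed_segment u v\<close> is an edge of \<open>P\<close>, then \<open>u \<noteq> v\<close> and both
  are extreme points of \<open>P\<close>.\<close>

definition vertices :: "'a::euclidean_space set \<Rightarrow> 'a set" where
  "vertices P = {v. v extreme_point_of P}"

definition adjacent :: "'a::euclidean_space set \<Rightarrow> 'a \<Rightarrow> 'a \<Rightarrow> bool" where
  "adjacent P u v \<longleftrightarrow> closed_segment u v edge_of P"

definition two_faces :: "'a::euclidean_space set \<Rightarrow> 'a set set" where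
  "two_faces P = {F. F face_of P \<and> aff_dim F = 2}"

definition num_edges :: "'a::euclidean_space set \<Rightarrow> nat" where
  "num_edges F = card {e. e edge_of F}"

definition simple_3_polytope :: "'a::euclidean_space set \<Rightarrow> bool" where
  "simple_3_polytope P \<longleftrightarrow> polytope P \<and> aff_dim P = 3 \<and>
     (\<forall>v\<in>vertices P. card {u \<in> vertices P. adjacent P u v} = 3)"

text \<open>The edge numbers of the 2-faces at \<open>v\<close>, with multiplicity, in non-increasing order. For a vertex of a simple
  3-polytope this list has length 3.\<close>

definition ell :: "'a::euclidean_space set \<Rightarrow> 'a \<Rightarrow> nat list" where
  "ell P v = rev (sorted_list_of_multiset (image_mset num_edges (mset_set {F \<in> two_faces P. v \<in> F})))"

definition resistance_positive :: "'a::euclidean_space set \<Rightarrow> bool" where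
  "resistance_positive P \<longleftrightarrow>
     (\<forall>v\<in>vertices P. resistance_curvature (vertices P) (adjacent P) v > 0)"

text \<open>\<open>Q\<close> arises from \<open>P\<close> by truncating the vertex \<open>v\<^sub>0\<close>: a hyperplane strictly separates \<open>v\<^sub>0\<close> from
  all other vertices, and the side containing \<open>v\<^sub>0\<close> is cut off. The combinatorial type of \<open>Q\<close> does
  not depend on the choice of the hyperplane.\<close>

definition delta_expansion :: "'a::euclidean_space set \<Rightarrow> 'a \<Rightarrow> 'a set \<Rightarrow> bool" where
  "delta_expansion P v\<^sub>0 Q \<longleftrightarrow>
     (\<exists>a b. a \<bullet> v\<^sub>0 > b \<and> (\<forall>w\<in>vertices P - {v\<^sub>0}. a \<bullet> w < b) \<and> Q = P \<inter> {x. a \<bullet> x \<le> b})"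

lemma delta_expansion_exists:
  fixes P :: "'a::euclidean_space set"
  assumes "polytope P" "v\<^sub>0 \<in> vertices P"
  shows "\<exists>Q. delta_expansion P v\<^sub>0 Q"
proof -
  have fin: "finite (vertices P)"
    using assms(1) finite_polyhedron_extreme_points polytope_imp_polyhedron
    unfolding vertices_def by blast
  have "{v\<^sub>0} face_of P"
    using assms(2) by (simp add: vertices_def face_of_singleton)
  then have "{v\<^sub>0} exposed_face_of P"
    using assms(1) exposed_face_of_polyhedron polytope_imp_polyhedron by blast
  then obtain a c where le: "P \<subseteq> {x. a \<bullet> x \<le> c}" and eq: "{v\<^sub>0} = P \<inter> {x. a \<bullet> x = c}"
    unfolding exposed_face_of_def by auto
  have lt: "a \<bullet> w < c" if "w \<in> vertices P - {v\<^sub>0}" for w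
  proof -
    have "w \<in> P" using that by (simp add: vertices_def extreme_point_of_def)
    then have "a \<bullet> w \<le> c" "a \<bullet> w \<noteq> c" using that le eq by auto
    then show ?thesis by simp
  qed
  have "\<exists>b<c. \<forall>w\<in>vertices P - {v\<^sub>0}. a \<bullet> w < b"
  proof (cases "vertices P - {v\<^sub>0} = {}")
    case True
    then show ?thesis using lt_ex[of c] by blast
  next
    case False
    define m where "m = Max ((\<lambda>w. a \<bullet> w) ` (vertices P - {v\<^sub>0}))"
    have "m < c" unfolding m_def using fin False lt by (subst Max_less_iff) auto
    then obtain b where "m < b" "b < c" using dense by blast
    moreover have "a \<bullet> w \<le> m" if "w \<in> vertices P - {v\<^sub>0}" for w
      unfolding m_def using fin that by (intro Max_ge) auto
    ultimately show ?thesis by (meson le_less_trans)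
  qed
  then obtain b where "b < c" "\<forall>w\<in>vertices P - {v\<^sub>0}. a \<bullet> w < b" by blast
  moreover have "a \<bullet> v\<^sub>0 = c" using eq by auto
  ultimately show ?thesis unfolding delta_expansion_def by blast
qed

end

theory Submission
  imports Defs
begin

text \<open>
  If \<open>f\<close> is the potential of a unit current from \<open>u\<close> to \<open>v\<close>, then \<open>f u - f v\<close> and the energy of \<open>f\<close>
  both equal the effective resistance, so lower bounds for the energy give upper bounds for resistances.
  At a vertex \<open>v\<close> of degree 3 the boundaries of the three incident 2-faces form a subdivided wheel: three
  spokes and three arcs with \<open>p\<close>, \<open>q\<close>, \<open>r\<close> edges, where \<open>p + 2\<close>, \<open>q + 2\<close>, \<open>r + 2\<close> are the numbers of edges
  of the 2-faces. Deleting all other edges (Rayleigh monotonicity) bounds the resistance sum at \<open>v\<close> by that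
  of the wheel, and this is less than 2 iff \<open>pqr < 3(p + q + r)\<close>. Equality holds for
  2-faces with (5,5,5) edges, but (6,5,4) still satisfies the inequality, as \<open>24 < 27\<close>. By the
  hypotheses every vertex of the \<open>\<Delta>\<close>-expansion has a type dominated by (6,5,4).

  The incidence structure at a vertex is read off the vertex figure: a hyperplane that separates the vertex from
  the others meets the polytope in a triangle, and its faces correspond to the faces of the polytope through
  the vertex. The same hyperplane section describes the faces created by the truncation.
\<close>

section \<open>Pseudoinverses of symmetric matrices\<close>

text \<open>Gram-Schmidt by induction on \<open>Y\<close>: project both \<open>b\<close> and the new
  vector \<open>c y\<close> onto the span of the old ones, then correct the residual of
  \<open>b\<close> by a multiple of the residual of \<open>c y\<close>. Working with residuals makes
  the argument indifferent to linear dependence.\<close>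

lemma normal_equations_solvable:
  fixes c :: "'b \<Rightarrow> 'a \<Rightarrow> real"
  assumes V: "finite V" and "finite Y"
  shows "\<exists>h. \<forall>y\<in>Y. (\<Sum>x\<in>V. c y x * (b x - (\<Sum>z\<in>Y. h z * c z x))) = 0"
  using assms(2)
proof (induction Y arbitrary: b rule: finite_induct)
  case empty
  then show ?case by simp
next
  case (insert y Y)
  obtain k where k: "\<And>z. z \<in> Y \<Longrightarrow> (\<Sum>x\<in>V. c z x * (c y x - (\<Sum>w\<in>Y. k w * c w x))) = 0"
    using insert.IH by blast
  obtain h where h: "\<And>z. z \<in> Y \<Longrightarrow> (\<Sum>x\<in>V. c z x * (b x - (\<Sum>w\<in>Y. h w * c w x))) = 0"
    using insert.IH by blast
  define d where "d x = c y x - (\<Sum>w\<in>Y. k w * c w x)" for x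
  define e where "e x = b x - (\<Sum>w\<in>Y. h w * c w x)" for x
  \<comment> \<open>If \<open>d\<close> vanishes on \<open>V\<close>, the quotient is 0 by
    convention and no correction is made.\<close>
  define t where "t = (\<Sum>x\<in>V. d x * e x) / (\<Sum>x\<in>V. d x * d x)"
  define h' where "h' z = (if z = y then t else h z - t * k z)" for z
  have cd: "(\<Sum>x\<in>V. c z x * d x) = 0" if "z \<in> Y" for z using k[OF that] by (simp add: d_def)
  have ce: "(\<Sum>x\<in>V. c z x * e x) = 0" if "z \<in> Y" for z using h[OF that] by (simp add: e_def)
  have res: "b x - (\<Sum>z\<in>insert y Y. h' z * c z x) = e x - t * d x" for x
  proof -
    have "(\<Sum>z\<in>insert y Y. h' z * c z x) = t * c y x + (\<Sum>z\<in>Y. (h z - t * k z) * c z x)"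
      using insert.hyps by (auto simp: h'_def intro!: sum.cong)
    also have "\<dots> = t * c y x + ((\<Sum>z\<in>Y. h z * c z x) - t * (\<Sum>z\<in>Y. k z * c z x))"
      by (simp add: sum_subtractf left_diff_distrib sum_distrib_left mult.assoc)
    finally show ?thesis by (simp add: d_def e_def algebra_simps)
  qed
  have de: "(\<Sum>x\<in>V. d x * (e x - t * d x)) = 0"
  proof (cases "(\<Sum>x\<in>V. d x * d x) = 0")
    case True
    then have "d x = 0" if "x \<in> V" for x using that V by (simp add: sum_nonneg_eq_0_iff)
    then show ?thesis by simp
  next
    case False
    have "(\<Sum>x\<in>V. d x * (e x - t * d x)) = (\<Sum>x\<in>V. d x * e x) - t * (\<Sum>x\<in>V. d x * d x)"
      by (simp add: sum_subtractf sum_distrib_left algebra_simps)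
    then show ?thesis using False by (simp add: t_def)
  qed
  have old: "(\<Sum>x\<in>V. c z x * (e x - t * d x)) = 0" if "z \<in> Y" for z
  proof -
    have "(\<Sum>x\<in>V. c z x * (e x - t * d x)) = (\<Sum>x\<in>V. c z x * e x) - t * (\<Sum>x\<in>V. c z x * d x)"
      by (simp add: sum_subtractf sum_distrib_left algebra_simps)
    then show ?thesis using cd ce that by simp
  qed
  \<comment> \<open>\<open>c y\<close> is \<open>d\<close> plus a combination of the old vectors,
    and the corrected residual is orthogonal to all of these.\<close>
  have new: "(\<Sum>x\<in>V. c y x * (e x - t * d x)) = 0"
  proof -
    have "(\<Sum>x\<in>V. c y x * (e x - t * d x))
        = (\<Sum>x\<in>V. d x * (e x - t * d x)) + (\<Sum>x\<in>V. \<Sum>w\<in>Y. k w * (c w x * (e x - t * d x)))"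
    proof -
      have "c y x * q = d x * q + (\<Sum>w\<in>Y. k w * (c w x * q))" for x q
        by (simp add: d_def left_diff_distrib sum_distrib_right mult.assoc)
      then show ?thesis by (simp add: sum.distrib)
    qed
    also have "(\<Sum>x\<in>V. \<Sum>w\<in>Y. k w * (c w x * (e x - t * d x)))
        = (\<Sum>w\<in>Y. k w * (\<Sum>x\<in>V. c w x * (e x - t * d x)))"
      by (subst sum.swap) (simp add: sum_distrib_left)
    finally show ?thesis using de old by simp
  qed
  show ?case
    by (intro exI[of _ h']) (simp only: res, use old new in auto)
qed

text \<open>Setting the entries outside \<open>V\<close> to 0 turns \<open>mat_eq\<close> into
  equality of functions, so that the Penrose conditions can be used by rewriting.\<close>

definition restr :: "'a set \<Rightarrow> ('a \<Rightarrow> 'a \<Rightarrow> real) \<Rightarrow> 'a \<Rightarrow> 'a \<Rightarrow> real" where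
  "restr V A = (\<lambda>x y. if x \<in> V \<and> y \<in> V then A x y else 0)"

definition mtranspose :: "('a \<Rightarrow> 'a \<Rightarrow> real) \<Rightarrow> 'a \<Rightarrow> 'a \<Rightarrow> real" where
  "mtranspose A = (\<lambda>x y. A y x)"

section \<open>Algebra of matrices indexed by \<open>V\<close>\<close>

lemma mat_mul_assoc: "mat_mul V (mat_mul V A B) C = mat_mul V A (mat_mul V B C)"
  unfolding mat_mul_def
  by (intro ext) (simp add: sum_distrib_left sum_distrib_right mult.assoc, subst sum.swap, rule refl)

lemma mtranspose_mat_mul: "mtranspose (mat_mul V A B) = mat_mul V (mtranspose B) (mtranspose A)"
  by (simp add: mtranspose_def mat_mul_def mult.commute)

lemma mtranspose_restr: "mtranspose (restr V A) = restr V (mtranspose A)"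
  by (auto simp: mtranspose_def restr_def fun_eq_iff)

lemma restr_mat_mul: "restr V (mat_mul V A B) = mat_mul V (restr V A) (restr V B)"
  by (auto simp: restr_def mat_mul_def fun_eq_iff intro!: sum.cong)

lemma mat_eq_iff_restr: "mat_eq V A B \<longleftrightarrow> restr V A = restr V B"
  by (auto simp: mat_eq_def restr_def fun_eq_iff)

lemma is_pseudoinverse_iff:
  "is_pseudoinverse V A X \<longleftrightarrow> restr V X = X \<and>
     mat_mul V (restr V A) (mat_mul V X (restr V A)) = restr V A \<and>
     mat_mul V X (mat_mul V (restr V A) X) = X \<and>
     mtranspose (mat_mul V (restr V A) X) = mat_mul V (restr V A) X \<and>
     mtranspose (mat_mul V X (restr V A)) = mat_mul V X (restr V A)"
proof -
  have supp: "(\<forall>x y. x \<notin> V \<or> y \<notin> V \<longrightarrow> X x y = 0) \<longleftrightarrow> restr V X = X"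
    by (auto simp: restr_def fun_eq_iff)
  have sym: "mat_sym V B \<longleftrightarrow> mtranspose (restr V B) = restr V B" for B
    by (simp add: mat_sym_def mat_eq_iff_restr mtranspose_restr) (auto simp: mtranspose_def)
  show ?thesis
    unfolding is_pseudoinverse_def supp
    by (auto simp: mat_eq_iff_restr sym restr_mat_mul mat_mul_assoc)
qed

text \<open>Penrose's argument: BX = (BY)(BX), and transposing the two symmetric factors gives BX =
  BY; likewise XB = YB. Then X = XBX = XBY = YBY = Y.\<close>

lemma is_pseudoinverse_unique:
  assumes "is_pseudoinverse V A X" "is_pseudoinverse V A Y"
  shows "X = Y"
proof -
  define B where "B = restr V A"
  note X = assms(1)[unfolded is_pseudoinverse_iff, folded B_def]
  note Y = assms(2)[unfolded is_pseudoinverse_iff, folded B_def]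
  have BX: "mat_mul V B X = mat_mul V B Y"
    using X Y by (metis mat_mul_assoc mtranspose_mat_mul)
  have XB: "mat_mul V X B = mat_mul V Y B"
    using X Y by (metis mat_mul_assoc mtranspose_mat_mul)
  show ?thesis using X Y BX XB by (metis mat_mul_assoc)
qed

text \<open>The diagonal entries of the transpose of \<open>D\<close> times \<open>D\<close> are the
  sums of squares of the columns of \<open>D\<close>.\<close>

lemma mat_mul_mtranspose_self_eq_0:
  assumes "finite V" "restr V D = D" "mat_mul V (mtranspose D) D = (\<lambda>_ _. 0)"
  shows "D = (\<lambda>_ _. 0)"
proof (intro ext)
  fix x y
  have "(\<Sum>z\<in>V. D z y * D z y) = 0"
    using fun_cong[OF fun_cong[OF assms(3)], of y y] by (simp add: mat_mul_def mtranspose_def)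
  then have "D z y = 0" if "z \<in> V" for z using that assms(1) by (simp add: sum_nonneg_eq_0_iff)
  moreover have "D x y = 0" if "x \<notin> V"
  proof -
    have "restr V D x y = 0" using that by (simp add: restr_def)
    then show ?thesis by (simp only: assms(2))
  qed
  ultimately show "D x y = 0" by blast
qed

text \<open>If \<open>B\<close> is symmetric and \<open>B B H = B\<close>, as the normal equations provide, then \<open>H\<^sup>T B H\<close> is the pseudoinverse.\<close>

lemma is_pseudoinverse_exists:
  assumes V: "finite V" and A: "mat_sym V A"
  shows "\<exists>X. is_pseudoinverse V A X"
proof -
  define B where "B = restr V A"
  have trB: "mtranspose B = B" and rB: "restr V B = B"
    using A by (auto simp: B_def mat_sym_def mat_eq_iff_restr mtranspose_def restr_def fun_eq_iff)
  \<comment> \<open>Column \<open>w\<close> of \<open>H\<close> is a least-squares solution for the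
    \<open>w\<close>-th unit vector; together the normal equations say B B H = B.\<close>
  have "\<forall>w. \<exists>h. \<forall>y\<in>V. (\<Sum>x\<in>V. B x y * ((if x = w then 1 else 0) - (\<Sum>z\<in>V. h z * B x z))) = 0"
    by (intro allI normal_equations_solvable[OF V V, of "\<lambda>y x. B x y"])
  from choice[OF this] obtain h where h: "\<And>w y. y \<in> V \<Longrightarrow>
      (\<Sum>x\<in>V. B x y * ((if x = w then 1 else 0) - (\<Sum>z\<in>V. h w z * B x z))) = 0"
    by blast
  define H where "H = restr V (\<lambda>z w. h w z)"
  have BBH: "mat_mul V B (mat_mul V B H) = B"
  proof (intro ext)
    fix y w
    show "mat_mul V B (mat_mul V B H) y w = B y w"
    proof (cases "y \<in> V \<and> w \<in> V")
      case True
      have BS: "B x z = B z x" for x z using fun_cong[OF fun_cong[OF trB], of z x] by (simp add: mtranspose_def)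
      have "(\<Sum>x\<in>V. B x y * ((if x = w then 1 else 0) - (\<Sum>z\<in>V. h w z * B x z)))
          = B w y - (\<Sum>x\<in>V. B x y * (\<Sum>z\<in>V. B x z * h w z))"
      proof -
        have "(\<Sum>x\<in>V. B x y * (if x = w then 1 else 0)) = B w y"
          using V True by (simp add: if_distrib cong: if_cong)
        then show ?thesis by (simp add: right_diff_distrib sum_subtractf mult.commute)
      qed
      also have "(\<Sum>x\<in>V. B x y * (\<Sum>z\<in>V. B x z * h w z)) = mat_mul V B (mat_mul V B H) y w"
        using True BS by (auto simp: mat_mul_def H_def restr_def intro!: sum.cong)
      finally show ?thesis using h[of y w] True BS by simp
    next
      case False
      then show ?thesis using rB by (auto simp: mat_mul_def H_def B_def restr_def)
    qed
  qed
  have rH: "restr V H = H" by (auto simp: H_def restr_def fun_eq_iff)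
  have HBB: "mat_mul V (mtranspose H) (mat_mul V B B) = B"
    using BBH trB by (metis mat_mul_assoc mtranspose_mat_mul)
  \<comment> \<open>Both sides equal H^T B B H, by \<open>BBH\<close> and its transpose
    \<open>HBB\<close>.\<close>
  have BH: "mat_mul V (mtranspose H) B = mat_mul V B H"
    by (metis BBH HBB mat_mul_assoc)
  \<comment> \<open>The defect in B H B = B. It satisfies B D = 0 and has the form B E, so D^T D =
    E^T B D = 0 and hence D = 0.\<close>
  define D where "D = (\<lambda>x y. mat_mul V B (mat_mul V H B) x y - B x y)"
  have BD: "mat_mul V B D = (\<lambda>_ _. 0)"
  proof -
    have "mat_mul V B D = (\<lambda>x y. mat_mul V B (mat_mul V B (mat_mul V H B)) x y - mat_mul V B B x y)"
      by (auto simp: D_def mat_mul_def right_diff_distrib sum_subtractf)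
    then show ?thesis using BBH by (simp flip: mat_mul_assoc)
  qed
  define E where "E = (\<lambda>x y. mat_mul V H B x y - (if x = y then 1 else 0))"
  have D_eq: "D = mat_mul V B E"
  proof (intro ext)
    fix x y
    have "(\<Sum>z\<in>V. B x z * (if z = y then 1 else 0)) = B x y"
      using V rB by (auto simp: if_distrib B_def restr_def cong: if_cong)
    then show "D x y = mat_mul V B E x y"
      by (simp add: D_def E_def mat_mul_def right_diff_distrib sum_subtractf)
  qed
  have "mtranspose D = mat_mul V (mtranspose E) B"
    unfolding D_eq mtranspose_mat_mul trB ..
  then have "mat_mul V (mtranspose D) D = mat_mul V (mtranspose E) (mat_mul V B D)"
    by (simp only: mat_mul_assoc)
  also have "\<dots> = (\<lambda>_ _. 0)" unfolding BD by (simp add: mat_mul_def)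
  finally have DD: "mat_mul V (mtranspose D) D = (\<lambda>_ _. 0)" .
  have "restr V (mat_mul V B (mat_mul V H B)) = mat_mul V B (mat_mul V H B)"
    by (simp only: restr_mat_mul rB rH)
  then have "mat_mul V B (mat_mul V H B) x y = 0 \<and> B x y = 0" if "\<not> (x \<in> V \<and> y \<in> V)" for x y
    using that rB by (metis restr_def)
  then have "restr V D = D" by (fastforce simp: D_def restr_def fun_eq_iff)
  then have "D = (\<lambda>_ _. 0)" using mat_mul_mtranspose_self_eq_0[OF V] DD by blast
  then have BHB: "mat_mul V B (mat_mul V H B) = B"
    by (simp add: D_def fun_eq_iff)
  have BHTB: "mat_mul V B (mat_mul V (mtranspose H) B) = B"
    using BHB trB by (metis mat_mul_assoc mtranspose_mat_mul)
  define X where "X = mat_mul V (mtranspose H) (mat_mul V B H)"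
  \<comment> \<open>Both products of \<open>B\<close> with \<open>X\<close> turn out to be B H,
    which is symmetric; this settles two of the Penrose conditions at once.\<close>
  have BX: "mat_mul V B X = mat_mul V B H"
    unfolding X_def by (subst mat_mul_assoc [symmetric])+ (simp only: BHTB[unfolded mat_mul_assoc [symmetric]])
  have XB: "mat_mul V X B = mat_mul V B H"
    unfolding X_def by (simp only: mat_mul_assoc BHB BH)
  have sym: "mtranspose (mat_mul V B H) = mat_mul V B H"
    by (simp only: mtranspose_mat_mul trB BH)
  have 1: "restr V X = X"
    by (simp only: X_def restr_mat_mul rB rH mtranspose_restr [symmetric])
  have 2: "mat_mul V B (mat_mul V X B) = B" by (simp only: XB BBH)
  have "mat_mul V X (mat_mul V B X) = mat_mul V (mat_mul V X B) X" by (simp only: mat_mul_assoc)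
  also have "\<dots> = mat_mul V (mat_mul V (mtranspose H) B) X" by (simp only: XB BH)
  also have "\<dots> = mat_mul V (mtranspose H) (mat_mul V B X)" by (simp only: mat_mul_assoc)
  also have "\<dots> = X" by (subst BX) (simp only: X_def)
  finally have 3: "mat_mul V X (mat_mul V B X) = X" .
  show ?thesis
    unfolding is_pseudoinverse_iff B_def [symmetric] using 1 2 3 by (intro exI[of _ X]) (simp add: BX XB sym)
qed

lemma is_pseudoinverse_pseudoinverse:
  assumes "finite V" "mat_sym V A"
  shows "is_pseudoinverse V A (pseudoinverse V A)"
  unfolding pseudoinverse_def
  using is_pseudoinverse_exists[OF assms] is_pseudoinverse_unique by (metis theI)

section \<open>Resistance curvature and wheels\<close>

text \<open>The Dirichlet energy. The double sum meets every edge in both directions, hence the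
  division by 2.\<close>

definition quad_form :: "'a set \<Rightarrow> ('a \<Rightarrow> 'a \<Rightarrow> bool) \<Rightarrow> ('a \<Rightarrow> real) \<Rightarrow> real" where
  "quad_form V adj f = (\<Sum>x\<in>V. \<Sum>y\<in>V. if adj x y then (f x - f y)\<^sup>2 else 0) / 2"

text \<open>Discrete Green identity: the left side is the sum of c x y (f x - f y) f x, and
  averaging it with the copy in which x and y are exchanged produces the squares.\<close>

lemma quad_form_eq:
  assumes V: "finite V" and sym: "\<And>x y. adj x y \<Longrightarrow> adj y x"
  shows "(\<Sum>x\<in>V. f x * (\<Sum>y\<in>V. laplacian V adj x y * f y)) = quad_form V adj f"
proof -
  define c where "c x y = (if adj x y then 1 else 0::real)" for x y
  have csym: "c x y = c y x" for x y using sym by (auto simp: c_def)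
  have deg: "real (card {z \<in> V. adj x z}) = (\<Sum>y\<in>V. c x y)" for x
    using V by (simp add: c_def sum.If_cases Int_def)
  have "(\<Sum>y\<in>V. laplacian V adj x y * f y) = (\<Sum>y\<in>V. c x y * (f x - f y))" if "x \<in> V" for x
  proof -
    have "(\<Sum>y\<in>V. laplacian V adj x y * f y)
        = (\<Sum>y\<in>V. (if x = y then (\<Sum>y\<in>V. c x y) else 0) * f y) - (\<Sum>y\<in>V. c x y * f y)"
      unfolding laplacian_def degree_matrix_def deg adjacency_matrix_def c_def [symmetric]
      by (simp add: left_diff_distrib sum_subtractf)
    also have "(\<Sum>y\<in>V. (if x = y then (\<Sum>y\<in>V. c x y) else 0) * f y) = (\<Sum>y\<in>V. c x y) * f x"
      using V that by (simp add: if_distrib [of "\<lambda>a. a * _"] cong: if_cong)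
    finally show ?thesis by (simp add: right_diff_distrib sum_subtractf sum_distrib_right)
  qed
  then have 1: "(\<Sum>x\<in>V. f x * (\<Sum>y\<in>V. laplacian V adj x y * f y))
      = (\<Sum>x\<in>V. \<Sum>y\<in>V. c x y * (f x - f y) * f x)"
    by (simp add: sum_distrib_left mult_ac)
  have 2: "(\<Sum>x\<in>V. \<Sum>y\<in>V. c x y * (f x - f y) * f x)
      = (\<Sum>x\<in>V. \<Sum>y\<in>V. c x y * (f y - f x) * f y)"
    by (subst sum.swap) (simp add: csym)
  have "quad_form V adj f = (\<Sum>x\<in>V. \<Sum>y\<in>V. c x y * (f x - f y)\<^sup>2) / 2"
    unfolding quad_form_def c_def by (intro arg_cong[of _ _ "\<lambda>x. x / 2"] sum.cong) auto
  also have "(\<Sum>x\<in>V. \<Sum>y\<in>V. c x y * (f x - f y)\<^sup>2) =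
      (\<Sum>x\<in>V. \<Sum>y\<in>V. c x y * (f x - f y) * f x) + (\<Sum>x\<in>V. \<Sum>y\<in>V. c x y * (f y - f x) * f y)"
    by (simp add: sum.distrib [symmetric] power2_eq_square algebra_simps)
  finally show ?thesis using 1 2 by simp
qed

lemma mat_sym_laplacian:
  assumes sym: "\<And>x y. adj x y \<Longrightarrow> adj y x"
  shows "mat_sym V (laplacian V adj)"
  unfolding mat_sym_def mat_eq_def laplacian_def degree_matrix_def adjacency_matrix_def
  using sym by (auto 0 3)

text \<open>The potential is the pseudoinverse applied to \<open>b\<close>. What needs proof is that
  it solves L f = b on \<open>V\<close>; then its energy is the inner product of f and b, which is f
  u - f v.\<close>

lemma effective_resistance_potential:
  assumes V: "finite V" and sym: "\<And>x y. adj x y \<Longrightarrow> adj y x"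
    and uv: "u \<in> V" "v \<in> V" "adj u v"
  obtains f where "f u - f v = effective_resistance V adj u v"
    and "quad_form V adj f = effective_resistance V adj u v"
proof -
  define L where "L = laplacian V adj"
  define X where "X = pseudoinverse V L"
  define b where "b x = (indicator {u} x - indicator {v} x :: real)" for x
  define f where "f x = (\<Sum>y\<in>V. X x y * b y)" for x
  define B where "B = restr V L"
  have Lsym: "mat_sym V L" unfolding L_def using sym by (rule mat_sym_laplacian)
  have "is_pseudoinverse V L X"
    unfolding X_def using V Lsym by (rule is_pseudoinverse_pseudoinverse)
  note X = this[unfolded is_pseudoinverse_iff, folded B_def]
  have trB: "mtranspose B = B"
    using Lsym by (auto simp: B_def mat_sym_def mat_eq_iff_restr mtranspose_def restr_def fun_eq_iff)
  have BBX: "mat_mul V B (mat_mul V B X) = B"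
    using X trB by (metis mat_mul_assoc mtranspose_mat_mul)
  have bsum: "(\<Sum>x\<in>V. b x * g x) = g u - g v" for g
    using V uv by (simp add: b_def left_diff_distrib sum_subtractf indicator_def if_distrib
        [of "\<lambda>a. a * _"] cong: if_cong)
  define p where "p x = (\<Sum>y\<in>V. B x y * f y)" for x
  define g where "g x = b x - p x" for x
  have p_eq: "p x = (\<Sum>y\<in>V. mat_mul V B X x y * b y)" for x
    unfolding p_def f_def mat_mul_def
    by (simp add: sum_distrib_left sum_distrib_right mult.assoc) (subst sum.swap, rule refl)
  have Bg: "(\<Sum>y\<in>V. B x y * g y) = 0" for x
  proof -
    have "(\<Sum>y\<in>V. B x y * p y) = (\<Sum>y\<in>V. mat_mul V B (mat_mul V B X) x y * b y)"
      unfolding p_eq mat_mul_def [of V B "mat_mul V B X"]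
      by (simp add: sum_distrib_left sum_distrib_right mult.assoc) (subst sum.swap, rule refl)
    then show ?thesis using BBX by (simp add: g_def right_diff_distrib sum_subtractf)
  qed
  have BL: "(\<Sum>y\<in>V. B x y * h y) = (\<Sum>y\<in>V. L x y * h y)" if "x \<in> V" for x h
    using that by (auto simp: B_def restr_def intro!: sum.cong)
  have quad: "quad_form V adj h = (\<Sum>x\<in>V. h x * (\<Sum>y\<in>V. B x y * h y))" for h
    using quad_form_eq[OF V sym, where f = h] BL by (simp add: L_def)
  \<comment> \<open>The residual \<open>g\<close> lies in the kernel of L, so its energy is 0 and it
    agrees at the ends of every edge. Adjacency of \<open>u\<close> and \<open>v\<close> thus takes
    the place of connectedness of the graph.\<close>
  have "quad_form V adj g = 0" unfolding quad Bg by simp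
  then have "(\<Sum>x\<in>V. \<Sum>y\<in>V. if adj x y then (g x - g y)\<^sup>2 else 0) = 0"
    by (simp add: quad_form_def)
  then have "(\<Sum>y\<in>V. if adj u y then (g u - g y)\<^sup>2 else 0) = 0"
    by (subst (asm) sum_nonneg_eq_0_iff) (use V uv in \<open>auto intro!: sum_nonneg\<close>)
  then have "(if adj u v then (g u - g v)\<^sup>2 else 0) = 0"
    by (subst (asm) sum_nonneg_eq_0_iff) (use V uv in auto)
  then have guv: "g u = g v" using uv by simp
  \<comment> \<open>The squared norm of \<open>g\<close> is its inner product with b, namely g u - g
    v = 0, minus its inner product with L f, which vanishes because L is symmetric and L g =
    0.\<close>
  have "(\<Sum>x\<in>V. g x * g x) = (\<Sum>x\<in>V. b x * g x) - (\<Sum>x\<in>V. \<Sum>y\<in>V. g x * (B x y * f y))"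
  proof -
    have "g x * g x = b x * g x - (\<Sum>y\<in>V. g x * (B x y * f y))" for x
    proof -
      have "g x * g x = g x * (b x - p x)" by (simp add: g_def)
      also have "\<dots> = b x * g x - g x * p x" by (simp add: algebra_simps)
      finally show ?thesis by (simp add: p_def sum_distrib_left)
    qed
    then show ?thesis by (simp add: sum_subtractf)
  qed
  also have "(\<Sum>x\<in>V. \<Sum>y\<in>V. g x * (B x y * f y)) = (\<Sum>y\<in>V. f y * (\<Sum>x\<in>V. B x y * g x))"
    by (subst sum.swap) (simp add: sum_distrib_left mult_ac)
  also have "\<dots> = (\<Sum>y\<in>V. f y * (\<Sum>x\<in>V. B y x * g x))"
    using trB by (auto simp: mtranspose_def fun_eq_iff intro!: sum.cong)
  finally have "(\<Sum>x\<in>V. g x * g x) = 0" using Bg bsum[of g] guv by simp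
  then have "g x = 0" if "x \<in> V" for x using that V by (simp add: sum_nonneg_eq_0_iff)
  then have pb: "p x = b x" if "x \<in> V" for x using that by (simp add: g_def)
  have r: "effective_resistance V adj u v = f u - f v"
  proof -
    have "effective_resistance V adj u v = (\<Sum>x\<in>V. b x * f x)"
      by (simp add: effective_resistance_def X_def L_def f_def b_def sum_distrib_left mult.assoc)
    then show ?thesis by (simp add: bsum)
  qed
  have "quad_form V adj f = (\<Sum>x\<in>V. f x * p x)" by (simp add: quad p_def)
  also have "\<dots> = (\<Sum>x\<in>V. b x * f x)" using pb by (auto intro!: sum.cong)
  finally have "quad_form V adj f = f u - f v" by (simp add: bsum)
  with r show ?thesis by (intro that) auto
qed

text \<open>The energy of a wheel with the hub at potential 0, the rim vertices at potentials x, y,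
  z, unit spokes, and rim conductances \<alpha> between x and y, \<beta> between y and z, \<gamma>
  between z and x.\<close>

definition wheel_form :: "real \<Rightarrow> real \<Rightarrow> real \<Rightarrow> real \<Rightarrow> real \<Rightarrow> real \<Rightarrow> real" where
  "wheel_form \<alpha> \<beta> \<gamma> x y z = x\<^sup>2 + y\<^sup>2 + z\<^sup>2 + \<alpha> * (x - y)\<^sup>2 + \<beta> * (y - z)\<^sup>2 + \<gamma> * (z - x)\<^sup>2"

text \<open>The symmetric matrix of \<open>wheel_form\<close> has determinant \<open>?d\<close>, and
  \<open>?a\<close> is its minor complementary to x, so minimising over y and z leaves (?d / ?a)
  x^2. The identity in the proof completes the square in y and then in z; \<open>m\<close> is the
  diagonal entry for y.\<close>

lemma wheel_form_lower_bound:
  assumes "\<alpha> \<ge> 0" "\<beta> \<ge> 0" "\<gamma> \<ge> 0"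
  shows "(1 + 2 * (\<alpha> + \<beta> + \<gamma>) + 3 * (\<alpha> * \<beta> + \<beta> * \<gamma> + \<gamma> * \<alpha>)) * x\<^sup>2
    \<le> ((1 + \<alpha> + \<beta>) * (1 + \<beta> + \<gamma>) - \<beta>\<^sup>2) * wheel_form \<alpha> \<beta> \<gamma> x y z" (is "?d * _ \<le> ?a * ?W")
proof -
  define m where "m = 1 + \<alpha> + \<beta>"
  define b where "b = - m * \<gamma> - \<alpha> * \<beta>"
  have m: "m > 0" using assms by (simp add: m_def)
  have a: "?a \<ge> 0"
  proof -
    have "?a = 1 + \<alpha> + \<gamma> + 2 * \<beta> + \<alpha> * \<beta> + \<beta> * \<gamma> + \<gamma> * \<alpha>" by (simp add: algebra_simps power2_eq_square)
    then show ?thesis using assms by simp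
  qed
  have "m * (?a * ?W - ?d * x\<^sup>2) = ?a * (m * y - \<alpha> * x - \<beta> * z)\<^sup>2 + (?a * z + b * x)\<^sup>2"
    unfolding m_def b_def wheel_form_def by algebra
  also have "\<dots> \<ge> 0" using a by simp
  finally show ?thesis using m by (simp add: zero_le_mult_iff)
qed

text \<open>For the unit current potential between a neighbor and \<open>v\<close>, the potential
  difference and the energy both equal r. With the previous lemma, d r^2 is at most a r, so r is at
  most a / d. The three minors add up to 3 + 4 s + 3 t, where s is the sum of the conductances and t
  that of their pairwise products, and this is below 2 d exactly when t > 1/3.\<close>

lemma resistance_curvature_pos_of_wheel:
  fixes V :: "'a set"
  assumes V: "finite V" and sym: "\<And>x y. adj x y \<Longrightarrow> adj y x"
    and nbrs: "{u \<in> V. adj u v} = {x, y, z}" and v: "v \<in> V"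
    and dist: "x \<noteq> y" "y \<noteq> z" "z \<noteq> x"
    and nn: "\<alpha> \<ge> 0" "\<beta> \<ge> 0" "\<gamma> \<ge> 0"
    and quad: "\<And>f. quad_form V adj f \<ge> wheel_form \<alpha> \<beta> \<gamma> (f x - f v) (f y - f v) (f z - f v)"
    and large: "\<alpha> * \<beta> + \<beta> * \<gamma> + \<gamma> * \<alpha> > 1 / 3"
  shows "resistance_curvature V adj v > 0"
proof -
  define r where "r u = effective_resistance V adj u v" for u
  define D where "D = 1 + 2 * (\<alpha> + \<beta> + \<gamma>) + 3 * (\<alpha> * \<beta> + \<beta> * \<gamma> + \<gamma> * \<alpha>)"
  have D: "D > 0" unfolding D_def using nn by (auto intro!: add_pos_nonneg)
  have minor: "(1 + p + q) * (1 + q + s) - q\<^sup>2 = 1 + p + 2 * q + s + (p * q + q * s + s * p)" for p q s :: real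
    by (simp add: algebra_simps power2_eq_square)
  \<comment> \<open>Stated for a cyclic relabelling with \<open>u\<close> in first position, so that
    one argument serves all three neighbors; \<open>D\<close> and the form are invariant under the
    rotation.\<close>
  have bound: "r u * D \<le> 1 + p + 2 * q + s + (p * q + q * s + s * p)"
    if u: "u \<in> {x, y, z}" and pqs: "p \<ge> 0" "q \<ge> 0" "s \<ge> 0"
      and Dpqs: "D = 1 + 2 * (p + q + s) + 3 * (p * q + q * s + s * p)"
      and form: "\<And>f. wheel_form p q s (f u - f v) (f a - f v) (f b - f v) \<le> quad_form V adj f" for u a b p q s
  proof -
    let ?m = "1 + p + 2 * q + s + (p * q + q * s + s * p)"
    have uV: "u \<in> V" "adj u v" using nbrs u by auto
    have m: "?m \<ge> 0" using pqs by simp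
    obtain f where f: "f u - f v = r u" "quad_form V adj f = r u"
      unfolding r_def using effective_resistance_potential[of V adj u v] V sym uV v by metis
    have "D * (r u)\<^sup>2 \<le> ?m * wheel_form p q s (f u - f v) (f a - f v) (f b - f v)"
      using wheel_form_lower_bound[OF pqs, of "r u"] unfolding minor Dpqs f(1) by blast
    also have "\<dots> \<le> ?m * r u" using mult_left_mono[OF form m, of f] unfolding f(2) .
    finally have "D * (r u)\<^sup>2 \<le> ?m * r u" .
    moreover have "r u \<ge> 0"
      unfolding f(2) [symmetric] quad_form_def by (auto intro!: sum_nonneg divide_nonneg_nonneg)
    ultimately show ?thesis using m D by (cases "r u = 0") (auto simp: power2_eq_square mult_ac)
  qed
  have "r x * D \<le> 1 + \<alpha> + 2 * \<beta> + \<gamma> + (\<alpha> * \<beta> + \<beta> * \<gamma> + \<gamma> * \<alpha>)"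
    by (rule bound[where a = y and b = z]) (use nn quad in \<open>auto simp: D_def\<close>)
  moreover have "r y * D \<le> 1 + \<beta> + 2 * \<gamma> + \<alpha> + (\<beta> * \<gamma> + \<gamma> * \<alpha> + \<alpha> * \<beta>)"
    by (rule bound[where a = z and b = x]) (use nn quad in \<open>auto simp: D_def wheel_form_def add_ac\<close>)
  moreover have "r z * D \<le> 1 + \<gamma> + 2 * \<alpha> + \<beta> + (\<gamma> * \<alpha> + \<alpha> * \<beta> + \<beta> * \<gamma>)"
    by (rule bound[where a = x and b = y]) (use nn quad in \<open>auto simp: D_def wheel_form_def add_ac\<close>)
  ultimately have "(r x + r y + r z) * D \<le> 3 + 4 * (\<alpha> + \<beta> + \<gamma>) + 3 * (\<alpha> * \<beta> + \<beta> * \<gamma> + \<gamma> * \<alpha>)"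
    by (simp add: distrib_right)
  also have "\<dots> < 2 * D" using large by (simp add: D_def algebra_simps)
  finally have "r x + r y + r z < 2" using D by simp
  then show ?thesis using dist by (simp add: resistance_curvature_def nbrs r_def)
qed

section \<open>Energy along a path\<close>

text \<open>A walk of least length is simple, since the stretch between two visits to the same point
  could be cut out.\<close>

lemma rtrancl_obtain_simple_path:
  assumes "(x, y) \<in> R\<^sup>*"
  obtains p n where "p 0 = x" "p n = y" "\<And>i. i < n \<Longrightarrow> (p i, p (Suc i)) \<in> R" "inj_on p {..n}"
proof -
  define n where "n = (LEAST n. (x, y) \<in> R ^^ n)"
  have "(x, y) \<in> R ^^ n"
    unfolding n_def using assms by (metis LeastI rtrancl_imp_relpow)
  then obtain p where p: "p 0 = x" "p n = y" "\<And>i. i < n \<Longrightarrow> (p i, p (Suc i)) \<in> R"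
    by (auto simp: relpow_fun_conv)
  have False if ij: "i < j" "j \<le> n" "p i = p j" for i j
  proof -
    have "(x, p i) \<in> R ^^ i"
      unfolding relpow_fun_conv using p ij by (intro exI[of _ p]) auto
    moreover have "(p j, y) \<in> R ^^ (n - j)"
      unfolding relpow_fun_conv using p ij by (intro exI[of _ "\<lambda>k. p (j + k)"]) auto
    ultimately have "(x, y) \<in> R ^^ (i + (n - j))"
      using ij(3) by (auto simp: relpow_add)
    moreover have "i + (n - j) < n" using ij by simp
    ultimately show False unfolding n_def by (metis not_less_Least)
  qed
  then have "inj_on p {..n}"
    by (intro linorder_inj_onI) auto
  with p show ?thesis using that by blast
qed

text \<open>Cauchy-Schwarz along a simple path. As \<open>R\<close> holds both orientations of each
  edge, a path of n steps uses 2 n of its pairs, so n is at most k. Connectedness and an edge count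
  therefore suffice, and the boundary of a polygon never has to be exhibited as a cycle.\<close>

lemma connected_energy_lower_bound:
  fixes f :: "'a \<Rightarrow> real"
  assumes R: "finite R" "sym R" and xy: "(x, y) \<in> R\<^sup>*" and card: "card R \<le> 2 * k"
  shows "(f x - f y)\<^sup>2 \<le> k * ((\<Sum>(u, w)\<in>R. (f u - f w)\<^sup>2) / 2)"
proof -
  obtain p n where p: "p 0 = x" "p n = y" "\<And>i. i < n \<Longrightarrow> (p i, p (Suc i)) \<in> R"
    and inj: "inj_on p {..n}"
    using xy by (rule rtrancl_obtain_simple_path) blast
  define g where "g i = (p i, p (Suc i))" for i
  define h where "h i = (p (Suc i), p i)" for i
  have eq: "i = j" if "p i = p j" "i \<le> n" "j \<le> n" for i j
    using inj that by (auto dest: inj_onD)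
  have injg: "inj_on g {..<n}" and injh: "inj_on h {..<n}"
    using eq by (auto simp: g_def h_def intro!: inj_onI)
  have disj: "g ` {..<n} \<inter> h ` {..<n} = {}"
  proof -
    have False if "i < n" "j < n" "p i = p (Suc j)" "p (Suc i) = p j" for i j
      using eq[of i "Suc j"] eq[of "Suc i" j] that by auto
    then show ?thesis by (auto simp: g_def h_def)
  qed
  have sub: "g ` {..<n} \<union> h ` {..<n} \<subseteq> R"
    using p(3) R(2) by (auto simp: g_def h_def dest: symD)
  have "card (g ` {..<n} \<union> h ` {..<n}) = 2 * n"
    using disj injg injh by (simp add: card_Un_disjoint card_image)
  then have "n \<le> k" using card_mono[OF R(1) sub] card by simp
  define S where "S = (\<Sum>i<n. (f (p i) - f (p (Suc i)))\<^sup>2)"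
  have "2 * S = (\<Sum>(u, w)\<in>g ` {..<n} \<union> h ` {..<n}. (f u - f w)\<^sup>2)"
    using disj injg injh
    by (simp add: sum.union_disjoint sum.reindex o_def S_def) (simp add: g_def h_def power2_commute)
  also have "\<dots> \<le> (\<Sum>(u, w)\<in>R. (f u - f w)\<^sup>2)"
    using R(1) sub by (intro sum_mono2) auto
  finally have S: "S \<le> (\<Sum>(u, w)\<in>R. (f u - f w)\<^sup>2) / 2" by simp
  have "f x - f y = (\<Sum>i<n. f (p i) - f (p (Suc i)))"
    using sum_lessThan_telescope'[of "\<lambda>i. f (p i)" n] p by simp
  then have "(f x - f y)\<^sup>2 \<le> S * n"
    unfolding S_def using sum_squared_le_sum_of_squares[of "\<lambda>i. f (p i) - f (p (Suc i))" "{..<n}"] by simp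
  also have "\<dots> \<le> ((\<Sum>(u, w)\<in>R. (f u - f w)\<^sup>2) / 2) * k"
    using S \<open>n \<le> k\<close> by (intro mult_mono) (auto intro!: sum_nonneg divide_nonneg_nonneg simp: case_prod_unfold)
  finally show ?thesis by (simp add: mult.commute)
qed

section \<open>Hyperplane sections near a vertex\<close>

text \<open>A face that meets the relative interior of a subset contains that subset. Hence two
  faces of the same set whose relative interiors share a point coincide.\<close>

lemma face_of_Int_eq:
  fixes P :: "'a::euclidean_space set"
  assumes "convex C" "F face_of P" "G face_of P \<inter> C" "x \<in> rel_interior G" "x \<in> rel_interior (F \<inter> C)"
  shows "G = F \<inter> C"
proof
  have FC: "F \<inter> C face_of P \<inter> C" using assms by (intro face_of_slice) auto
  have x: "x \<in> G" "x \<in> F \<inter> C" using assms rel_interior_subset by blast+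
  show "G \<subseteq> F \<inter> C"
    using subset_of_face_of[OF FC] face_of_imp_subset[OF assms(3)] assms(4) x by blast
  show "F \<inter> C \<subseteq> G"
    using subset_of_face_of[OF assms(3)] face_of_imp_subset[OF FC] assms(5) x by blast
qed

text \<open>Take the intersection of all faces containing x. If x were on its relative boundary, a
  facet through x would be a strictly smaller face of \<open>P\<close> containing x.\<close>

lemma polytope_obtain_face_rel_interior:
  fixes P :: "'a::euclidean_space set"
  assumes "polytope P" "x \<in> P"
  obtains F where "F face_of P" "x \<in> rel_interior F"
proof -
  let ?A = "{F. F face_of P \<and> x \<in> F}"
  have "P \<in> ?A" using assms by (simp add: face_of_refl polytope_imp_convex)
  then have F: "\<Inter> ?A face_of P" by (intro face_of_Inter) auto
  have "x \<in> rel_interior (\<Inter> ?A)"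
  proof (rule ccontr)
    assume "x \<notin> rel_interior (\<Inter> ?A)"
    moreover have ph: "polyhedron (\<Inter> ?A)"
      using F assms face_of_polytope_polytope polytope_imp_polyhedron by blast
    ultimately have "x \<in> \<Inter> ?A - rel_interior (\<Inter> ?A)" by auto
    then obtain G where G: "G facet_of \<Inter> ?A" "x \<in> G"
      unfolding rel_boundary_of_polyhedron[OF ph] by blast
    then have "G face_of P" using F facet_of_imp_face_of face_of_trans by blast
    then have "\<Inter> ?A \<subseteq> G" using G by blast
    then have "G = \<Inter> ?A" using facet_of_imp_subset[OF G(1)] by blast
    then show False using G(1) by simp
  qed
  with F show ?thesis by (rule that)
qed

section \<open>Vertices of a polytope and of its faces\<close>

lemma polytope_eq_convex_hull_vertices: "polytope P \<Longrightarrow> P = convex hull (vertices P)"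
  unfolding vertices_def by (intro Krein_Milman_Minkowski polytope_imp_compact polytope_imp_convex)

lemma finite_vertices: "polytope P \<Longrightarrow> finite (vertices P)"
  unfolding vertices_def using finite_polyhedron_extreme_points polytope_imp_polyhedron by blast

lemma vertices_face: "F face_of P \<Longrightarrow> vertices F = vertices P \<inter> F"
  unfolding vertices_def using extreme_point_of_face by blast

text \<open>The dimension of \<open>P\<close> is left open, so that the same results apply to a
  3-polytope and to its 2-faces through \<open>v\<close>. Both inequalities are strict: no vertex
  lies on the hyperplane.\<close>

locale vertex_cut =
  fixes P :: "'a::euclidean_space set" and v a :: 'a and b :: real
  assumes polytope: "polytope P" and vertex: "v \<in> vertices P" and above: "a \<bullet> v > b"
    and below: "\<And>w. w \<in> vertices P \<Longrightarrow> w \<noteq> v \<Longrightarrow> a \<bullet> w < b"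
begin

abbreviation H :: "'a set" where "H \<equiv> {x. a \<bullet> x = b}"
abbreviation L :: "'a set" where "L \<equiv> {x. a \<bullet> x \<le> b}"

lemma face_convex_hull: "F face_of P \<Longrightarrow> F = convex hull (vertices P \<inter> F)"
  using polytope face_of_polytope_polytope polytope_eq_convex_hull_vertices vertices_face by metis

lemma face_below:
  assumes "F face_of P" "v \<notin> F"
  shows "F \<subseteq> {x. a \<bullet> x < b}"
proof -
  have "convex hull (vertices P \<inter> F) \<subseteq> {x. a \<bullet> x < b}"
    using below assms(2) by (intro hull_minimal convex_halfspace_lt) auto
  then show ?thesis using face_convex_hull[OF assms(1)] by simp
qed

lemma face_meets_H:
  assumes "F face_of P" "x \<in> F" "a \<bullet> x = b"
  shows "v \<in> F" "F \<noteq> {v}"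
  using face_below[OF assms(1)] assms above by auto

lemma face_obtain_below:
  assumes "F face_of P" "F \<noteq> {}" "F \<noteq> {v}"
  obtains w where "w \<in> vertices P" "w \<in> F" "w \<noteq> v"
proof -
  have "vertices P \<inter> F \<noteq> {}" "vertices P \<inter> F \<noteq> {v}"
    using face_convex_hull[OF assms(1)] assms by auto
  then show ?thesis using that by blast
qed

text \<open>The values of the linear functional on \<open>F\<close> form a convex set having
  \<open>b\<close> in its interior, and relative interiors commute with linear images.\<close>

lemma rel_interior_meets_H:
  assumes F: "F face_of P" and v: "v \<in> F" "F \<noteq> {v}"
  obtains x where "x \<in> rel_interior F" "a \<bullet> x = b"
proof -
  obtain w where w: "w \<in> F" "a \<bullet> w < b" using face_obtain_below[OF F] v below by blast
  have lin: "linear (\<lambda>x. a \<bullet> x)" by (rule bounded_linear.linear[OF bounded_linear_inner_right])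
  have cF: "convex F" using F face_of_imp_convex by blast
  then have conv: "convex ((\<lambda>x. a \<bullet> x) ` F)" using lin by (rule convex_linear_image[rotated])
  have "{a \<bullet> w<..<a \<bullet> v} \<subseteq> (\<lambda>x. a \<bullet> x) ` F"
  proof -
    have "closed_segment (a \<bullet> w) (a \<bullet> v) \<subseteq> (\<lambda>x. a \<bullet> x) ` F"
      using conv w v by (intro closed_segment_subset) auto
    then show ?thesis using w above by (auto simp: closed_segment_eq_real_ivl)
  qed
  then have "b \<in> interior ((\<lambda>x. a \<bullet> x) ` F)"
    using w above by (intro interiorI[of "{a \<bullet> w<..<a \<bullet> v}"]) auto
  then have "b \<in> rel_interior ((\<lambda>x. a \<bullet> x) ` F)"
    using interior_subset_rel_interior by blast
  then have "b \<in> (\<lambda>x. a \<bullet> x) ` rel_interior F"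
    using rel_interior_convex_linear_image[OF lin cF] by simp
  then show ?thesis using that by auto
qed

lemma rel_interior_Int_H:
  assumes F: "F face_of P" and v: "v \<in> F" "F \<noteq> {v}"
  shows "rel_interior (F \<inter> H) = rel_interior F \<inter> H"
proof -
  obtain x where "x \<in> rel_interior F" "a \<bullet> x = b" using assms by (rule rel_interior_meets_H)
  then show ?thesis
    using F face_of_imp_convex by (intro convex_affine_rel_interior_Int affine_hyperplane) auto
qed

text \<open>The nonempty set \<open>rel_interior F \<inter> H\<close> is open in
  \<open>affine hull F \<inter> H\<close> and hence spans it. The dimension drops by exactly one
  because \<open>v\<close> is in the affine hull but not on the hyperplane.\<close>

lemma aff_dim_Int_H:
  assumes F: "F face_of P" and v: "v \<in> F" "F \<noteq> {v}"
  shows "aff_dim (F \<inter> H) = aff_dim F - 1"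
proof -
  obtain x where x: "x \<in> rel_interior F" "a \<bullet> x = b" using assms by (rule rel_interior_meets_H)
  let ?A = "affine hull F"
  have "affine hull (rel_interior F \<inter> H) = affine hull (?A \<inter> H)"
  proof -
    have aff: "affine (?A \<inter> H)" by (intro affine_Int affine_affine_hull affine_hyperplane)
    have "?A \<inter> rel_interior F = rel_interior F" using rel_interior_subset hull_subset[of F affine] by blast
    then have "openin (top_of_set ?A) (?A \<inter> rel_interior F)"
      using openin_rel_interior[of F] by argo
    then have "openin (top_of_set (?A \<inter> H)) (?A \<inter> H \<inter> rel_interior F)"
      by (rule openin_subtopology_Int_subset) (rule Int_lower1)
    moreover have "?A \<inter> H \<inter> rel_interior F = rel_interior F \<inter> H"
      using rel_interior_subset hull_subset[of F affine] by blast
    ultimately have "openin (top_of_set (affine hull (?A \<inter> H))) (rel_interior F \<inter> H)"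
      using hull_same[of affine, OF aff] by (simp only:)
    moreover have "rel_interior F \<inter> H \<noteq> {}" using x by blast
    ultimately show ?thesis by (rule affine_hull_openin)
  qed
  moreover have "rel_interior F \<inter> H \<subseteq> F \<inter> H" "F \<inter> H \<subseteq> ?A \<inter> H"
    using rel_interior_subset hull_subset[of F affine] by blast+
  ultimately have "aff_dim (F \<inter> H) = aff_dim (?A \<inter> H)"
    using aff_dim_subset[of "rel_interior F \<inter> H" "F \<inter> H"] aff_dim_subset[of "F \<inter> H" "?A \<inter> H"]
      aff_dim_affine_hull[of "rel_interior F \<inter> H"] aff_dim_affine_hull[of "?A \<inter> H"] by simp
  also have "\<dots> = aff_dim F - 1"
  proof -
    have "v \<in> ?A" using v hull_subset[of F affine] by blast
    then have "\<not> ?A \<subseteq> H" using above by auto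
    moreover have "?A \<inter> H \<noteq> {}" using x rel_interior_subset hull_subset[of F affine] by blast
    ultimately show ?thesis
      by (simp add: aff_dim_affine_Int_hyperplane)
  qed
  finally show ?thesis .
qed

text \<open>The section contains a relative interior point of \<open>F\<close>, and a face through
  such a point contains all of \<open>F\<close>. Faces through \<open>v\<close> are therefore
  determined by their sections.\<close>

lemma face_H_mono:
  assumes F: "F face_of P" "v \<in> F" "F \<noteq> {v}" and F': "F' face_of P" and sub: "F \<inter> H \<subseteq> F'"
  shows "F \<subseteq> F'"
proof -
  obtain x where "x \<in> rel_interior F" "a \<bullet> x = b" using F by (rule rel_interior_meets_H)
  then have "F' \<inter> rel_interior F \<noteq> {}" using sub rel_interior_subset by blast
  then show ?thesis using subset_of_face_of[OF F'] face_of_imp_subset F(1) by blast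
qed

text \<open>Choose a relative interior point x of \<open>G\<close> and let \<open>F\<close> be the
  face of \<open>P\<close> having x in its relative interior. Then \<open>G\<close> and
  \<open>F \<inter> H\<close> are faces of the section with a common relative interior
  point.\<close>

lemma face_of_slice_cases:
  assumes G: "G face_of P \<inter> H" "G \<noteq> {}"
  obtains F where "F face_of P" "v \<in> F" "F \<noteq> {v}" "G = F \<inter> H"
proof -
  have "convex G" using G face_of_imp_convex by blast
  then obtain x where x: "x \<in> rel_interior G" using G rel_interior_eq_empty by blast
  have "x \<in> P \<inter> H" using x rel_interior_subset face_of_imp_subset[OF G(1)] by blast
  then obtain F where F: "F face_of P" "x \<in> rel_interior F"
    using polytope polytope_obtain_face_rel_interior by blast
  have vF: "v \<in> F" "F \<noteq> {v}"
    using face_meets_H[OF F(1), of x] F rel_interior_subset \<open>x \<in> P \<inter> H\<close> by blast+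
  have "G = F \<inter> H"
    using F x \<open>x \<in> P \<inter> H\<close> rel_interior_Int_H[OF F(1) vF]
    by (intro face_of_Int_eq[OF _ F(1) G(1) x] convex_hyperplane) auto
  with F vF show ?thesis using that by blast
qed

text \<open>The face correspondence of the vertex figure, lowering dimensions by one. The bound on
  \<open>k\<close> keeps out the face \<open>{v}\<close>, which does not meet the
  hyperplane.\<close>

lemma slice_bij:
  assumes "k \<ge> 0"
  shows "bij_betw (\<lambda>F. F \<inter> H) {F. F face_of P \<and> aff_dim F = k + 1 \<and> v \<in> F} {G. G face_of P \<inter> H \<and> aff_dim G = k}"
proof (intro bij_betwI')
  fix F F' assume F: "F \<in> {F. F face_of P \<and> aff_dim F = k + 1 \<and> v \<in> F}"
    "F' \<in> {F. F face_of P \<and> aff_dim F = k + 1 \<and> v \<in> F}"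
  then have "F \<noteq> {v}" "F' \<noteq> {v}" using assms by auto
  then show "(F \<inter> H = F' \<inter> H) = (F = F')"
    using F face_H_mono[of F F'] face_H_mono[of F' F] by blast
next
  fix F assume F: "F \<in> {F. F face_of P \<and> aff_dim F = k + 1 \<and> v \<in> F}"
  then have "F \<noteq> {v}" using assms by auto
  then show "F \<inter> H \<in> {G. G face_of P \<inter> H \<and> aff_dim G = k}"
    using F aff_dim_Int_H[of F] by (auto intro!: face_of_slice convex_hyperplane)
next
  fix G assume G: "G \<in> {G. G face_of P \<inter> H \<and> aff_dim G = k}"
  then have "G \<noteq> {}" using assms by auto
  then obtain F where F: "F face_of P" "v \<in> F" "F \<noteq> {v}" "G = F \<inter> H"
    using G face_of_slice_cases by blast
  then show "\<exists>F\<in>{F. F face_of P \<and> aff_dim F = k + 1 \<and> v \<in> F}. G = F \<inter> H"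
    using aff_dim_Int_H[of F] G by force
qed

end

section \<open>Edges and 2-faces at a vertex\<close>

lemma vertex_cut_exists:
  assumes "polytope P" "v \<in> vertices P"
  obtains a b where "vertex_cut P v a b"
proof -
  obtain a b where "a \<bullet> v > b" "\<forall>w\<in>vertices P - {v}. a \<bullet> w < b"
    using delta_expansion_exists[OF assms] unfolding delta_expansion_def by blast
  then have "vertex_cut P v a b" using assms by unfold_locales auto
  then show ?thesis by (rule that)
qed

section \<open>Edges as segments between adjacent vertices\<close>

lemma vertices_closed_segment: "vertices (closed_segment x y) = {x, y}"
  by (auto simp: vertices_def extreme_point_of_segment)

lemma edge_obtain_segment:
  assumes "polytope P" "e edge_of P"
  obtains x y where "x \<noteq> y" "e = closed_segment x y" "vertices P \<inter> e = {x, y}"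
proof -
  have e: "e face_of P" "aff_dim e = 1" using assms(2) by (auto simp: edge_of_def)
  have "polytope e" using assms(1) e face_of_polytope_polytope by blast
  then have "compact e" "convex e" using polytope_imp_compact polytope_imp_convex by blast+
  moreover have "collinear e" "e \<noteq> {}" using e by (auto simp: collinear_aff_dim)
  ultimately obtain x y where xy: "e = closed_segment x y"
    using compact_convex_collinear_segment by blast
  then have "x \<noteq> y" using e by auto
  moreover have "vertices P \<inter> e = {x, y}"
    using vertices_face[OF e(1)] vertices_closed_segment[of x y] xy by simp
  ultimately show ?thesis using xy that by blast
qed

lemma adjacent_sym: "adjacent P u v \<Longrightarrow> adjacent P v u"
  by (simp add: adjacent_def closed_segment_commute)

lemma adjacentD:
  assumes "polytope P" "adjacent P u v"
  shows "u \<noteq> v" "vertices P \<inter> closed_segment u v = {u, v}"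
proof -
  have e: "closed_segment u v edge_of P" using assms by (simp add: adjacent_def)
  then show "u \<noteq> v" by (auto simp: edge_of_def)
  have "closed_segment u v face_of P" using e by (simp add: edge_of_def)
  then show "vertices P \<inter> closed_segment u v = {u, v}"
    using vertices_face[of "closed_segment u v" P] vertices_closed_segment[of u v] by simp
qed

lemma edge_eq_segment:
  assumes "polytope P" "e edge_of P" "u \<in> vertices P" "u \<in> e" "v \<in> vertices P" "v \<in> e" "u \<noteq> v"
  shows "e = closed_segment u v"
proof -
  obtain x y where xy: "e = closed_segment x y" "vertices P \<inter> e = {x, y}"
    using edge_obtain_segment[OF assms(1,2)] by metis
  then have "u \<in> {x, y}" "v \<in> {x, y}" using assms by blast+
  then show ?thesis using xy(1) assms(7) by (auto simp: closed_segment_commute)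
qed

lemma edge_obtain_adjacent:
  assumes "polytope P" "e edge_of P" "v \<in> vertices P" "v \<in> e"
  obtains u where "u \<in> vertices P" "adjacent P u v" "e = closed_segment u v"
proof -
  obtain x y where xy: "x \<noteq> y" "vertices P \<inter> e = {x, y}"
    using edge_obtain_segment[OF assms(1,2)] by metis
  define u where "u = (if v = x then y else x)"
  have "u \<in> vertices P" "u \<in> e" "u \<noteq> v" using xy assms(3,4) unfolding u_def by (auto split: if_splits)
  moreover from this have "e = closed_segment u v" using assms edge_eq_segment by blast
  ultimately show ?thesis using that assms(2) by (auto simp: adjacent_def)
qed

text \<open>Translates the degree in the graph into the number of edges through \<open>v\<close>,
  which is what the vertex figure counts.\<close>

lemma bij_betw_neighbours_edges:
  assumes "polytope P" "v \<in> vertices P"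
  shows "bij_betw (\<lambda>u. closed_segment u v) {u \<in> vertices P. adjacent P u v} {e. e edge_of P \<and> v \<in> e}"
proof (intro bij_betwI')
  fix u w assume u: "u \<in> {u \<in> vertices P. adjacent P u v}" and w: "w \<in> {u \<in> vertices P. adjacent P u v}"
  then have "{u, v} = {w, v}" if "closed_segment u v = closed_segment w v"
    using that adjacentD(2)[OF assms(1), of u v] adjacentD(2)[OF assms(1), of w v] by simp
  then show "(closed_segment u v = closed_segment w v) = (u = w)"
    using adjacentD(1)[OF assms(1)] u w by (auto simp: doubleton_eq_iff)
next
  fix u assume "u \<in> {u \<in> vertices P. adjacent P u v}"
  then show "closed_segment u v \<in> {e. e edge_of P \<and> v \<in> e}" by (auto simp: adjacent_def)
next
  fix e assume "e \<in> {e. e edge_of P \<and> v \<in> e}"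
  then show "\<exists>u\<in>{u \<in> vertices P. adjacent P u v}. e = closed_segment u v"
    using assms edge_obtain_adjacent by (metis (mono_tags, lifting) mem_Collect_eq)
qed

lemma faces_aff_dim_0: "{G. G face_of S \<and> aff_dim G = 0} = (\<lambda>x. {x}) ` vertices S"
  by (auto simp: vertices_def aff_dim_eq_0 face_of_singleton)

text \<open>The vertex figure of a polygon is a segment, and its two endpoints correspond to the
  edges at \<open>v\<close>.\<close>

lemma polygon_two_edges:
  assumes F: "polytope F" "aff_dim F = 2" and v: "v \<in> vertices F"
  shows "card {e. e edge_of F \<and> v \<in> e} = 2"
proof -
  obtain a b where "vertex_cut F v a b" using F(1) v by (rule vertex_cut_exists)
  then interpret vertex_cut F v a b .
  have vF: "v \<in> F" using v by (simp add: vertices_def extreme_point_of_def)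
  have face: "F face_of F" using F polytope_imp_convex face_of_refl by blast
  have "F \<noteq> {v}" using F by auto
  then have "aff_dim (F \<inter> H) = 1" using aff_dim_Int_H[OF face vF] F by simp
  moreover have poly: "polytope (F \<inter> H)"
    using F(1) by (intro polytope_Int_polyhedron polyhedron_hyperplane) auto
  ultimately have "(F \<inter> H) edge_of (F \<inter> H)"
    by (simp add: edge_of_def face_of_refl polytope_imp_convex)
  then obtain x y where "x \<noteq> y" "vertices (F \<inter> H) \<inter> (F \<inter> H) = {x, y}"
    using edge_obtain_segment[OF poly] by metis
  moreover have "vertices (F \<inter> H) \<subseteq> F \<inter> H" by (auto simp: vertices_def extreme_point_of_def)
  ultimately have "card (vertices (F \<inter> H)) = 2" by (simp add: inf_absorb1)
  then have "card {G. G face_of F \<inter> H \<and> aff_dim G = 0} = 2"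
    by (simp add: faces_aff_dim_0 card_image)
  then show ?thesis
    using bij_betw_same_card[OF slice_bij[of 0]] by (simp add: edge_of_def conj_ac)
qed

text \<open>The vertex figure is a polygon with at most three vertices, hence a triangle, and its
  incidences lift to \<open>P\<close>. The indices express opposition: \<open>F1\<close> is the
  2-face at \<open>v\<close> that does not contain \<open>e1\<close>, and so on. An upper bound on
  the degree is the form in which the degree is known for a truncation.\<close>

lemma vertex_structure:
  assumes P: "polytope P" "aff_dim P = 3" and v: "v \<in> vertices P"
    and deg: "card {e. e edge_of P \<and> v \<in> e} \<le> 3"
  obtains e1 e2 e3 F1 F2 F3 where
    "{e. e edge_of P \<and> v \<in> e} = {e1, e2, e3}" "e1 \<noteq> e2" "e2 \<noteq> e3" "e3 \<noteq> e1"
    "{F \<in> two_faces P. v \<in> F} = {F1, F2, F3}" "F1 \<noteq> F2" "F2 \<noteq> F3" "F3 \<noteq> F1"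
    "F2 \<inter> F3 = e1" "F3 \<inter> F1 = e2" "F1 \<inter> F2 = e3"
proof -
  obtain a b where "vertex_cut P v a b" using P(1) v by (rule vertex_cut_exists)
  then interpret vertex_cut P v a b .
  have vP: "v \<in> P" using v by (simp add: vertices_def extreme_point_of_def)
  have face: "P face_of P" using P polytope_imp_convex face_of_refl by blast
  define S where "S = P \<inter> H"
  define X where "X = vertices S"
  have "P \<noteq> {v}" using P by auto
  then have dim: "aff_dim S = 2" unfolding S_def using aff_dim_Int_H[OF face vP] P by simp
  have poly: "polytope S"
    unfolding S_def using P(1) by (intro polytope_Int_polyhedron polyhedron_hyperplane) auto
  have bij1: "bij_betw (\<lambda>F. F \<inter> H) {e. e edge_of P \<and> v \<in> e} {G. G face_of S \<and> aff_dim G = 0}"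
    using slice_bij[of 0] by (simp add: edge_of_def S_def)
  have bij2: "bij_betw (\<lambda>F. F \<inter> H) {F \<in> two_faces P. v \<in> F} {G. G face_of S \<and> aff_dim G = 1}"
    using slice_bij[of 1] by (simp add: two_faces_def S_def conj_ac)
  have "finite X" unfolding X_def using poly by (rule finite_vertices)
  have hull: "S = convex hull X" unfolding X_def using poly by (rule polytope_eq_convex_hull_vertices)
  have "card X = card {e. e edge_of P \<and> v \<in> e}"
    using bij_betw_same_card[OF bij1] by (simp add: faces_aff_dim_0 card_image X_def)
  \<comment> \<open>Dimension 2 forces at least three points, so \<open>X\<close> has exactly three
    and is affinely independent; the faces of \<open>S\<close> are then the hulls of the subsets of
    \<open>X\<close>.\<close>
  moreover have "aff_dim X = 2" using dim hull by (simp add: aff_dim_convex_hull)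
  ultimately have cX: "card X = 3"
    using deg aff_dim_le_card[OF \<open>finite X\<close>] by simp
  have indep: "\<not> affine_dependent X"
    using \<open>finite X\<close> \<open>aff_dim X = 2\<close> cX by (simp add: affine_independent_iff_card)
  obtain x1 x2 x3 where x: "X = {x1, x2, x3}" "x1 \<noteq> x2" "x2 \<noteq> x3" "x3 \<noteq> x1"
    using cX by (auto simp: card_3_iff)
  have faces1: "{G. G face_of S \<and> aff_dim G = 0} = {{x1}, {x2}, {x3}}"
    using x by (auto simp: faces_aff_dim_0 X_def)
  have faceS: "G face_of S \<longleftrightarrow> (\<exists>c. c \<subseteq> X \<and> G = convex hull c)" for G
    unfolding hull by (rule face_of_convex_hull_affine_independent[OF indep])
  have dimc: "aff_dim (convex hull c) = int (card c) - 1" if "c \<subseteq> X" for c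
    using affine_independent_subset[OF indep that] by (simp add: aff_dim_convex_hull affine_independent_iff_card)
  have pairs: "c \<subseteq> X \<and> card c = 2 \<longleftrightarrow> c \<in> {{x2, x3}, {x3, x1}, {x1, x2}}" for c
    using x by (auto simp: card_2_iff)
  have faces2: "{G. G face_of S \<and> aff_dim G = 1}
      = {convex hull {x2, x3}, convex hull {x3, x1}, convex hull {x1, x2}}"
  proof -
    have "{G. G face_of S \<and> aff_dim G = 1} = (hull) convex ` {c. c \<subseteq> X \<and> card c = 2}"
      using dimc by (auto simp: faceS)
    then show ?thesis unfolding pairs by auto
  qed
  have hull_vert: "c \<subseteq> d" if "c \<subseteq> X" "d \<subseteq> X" "c \<subseteq> convex hull d" for c d
  proof
    fix z assume "z \<in> c"
    have "convex hull d face_of S" using that faceS by blast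
    then have "z extreme_point_of convex hull d"
      using \<open>z \<in> c\<close> that extreme_point_of_face unfolding X_def vertices_def by blast
    then show "z \<in> d" by (rule extreme_point_of_convex_hull)
  qed
  \<comment> \<open>The intersection of two sides is again a face, hence the hull of a subset
    \<open>c\<close> of the corners, and \<open>c\<close> lies in both pairs.\<close>
  have hull_Int: "convex hull {p, q} \<inter> convex hull {p, r} = {p}"
    if "{p, q, r} = X" "p \<noteq> q" "q \<noteq> r" "p \<noteq> r" for p q r
  proof -
    have "convex hull {p, q} \<inter> convex hull {p, r} face_of S"
    proof (rule face_of_Int)
      have "{p, q} \<subseteq> X" "{p, r} \<subseteq> X" using that(1) by blast+
      then show "convex hull {p, q} face_of S" "convex hull {p, r} face_of S" using faceS by blast+
    qed
    then obtain c where c: "c \<subseteq> X" "convex hull {p, q} \<inter> convex hull {p, r} = convex hull c"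
      using faceS by blast
    have "c \<subseteq> convex hull c" by (rule hull_subset)
    then have "c \<subseteq> convex hull {p, q}" "c \<subseteq> convex hull {p, r}" using c(2) by blast+
    moreover have "{p, q} \<subseteq> X" "{p, r} \<subseteq> X" using that(1) by blast+
    ultimately have "c \<subseteq> {p, q}" "c \<subseteq> {p, r}"
      using hull_vert[of c "{p, q}"] hull_vert[of c "{p, r}"] c(1) by simp_all
    then have "c \<subseteq> {p}" using that by auto
    moreover have "p \<in> convex hull c" unfolding c(2)[symmetric] by (simp add: hull_inc)
    ultimately have "c = {p}" by (auto simp: subset_singleton_iff)
    then show ?thesis using c(2) by simp
  qed
  have ne: "convex hull {p, q} \<noteq> convex hull {p, r}"
    if "{p, q, r} = X" "p \<noteq> q" "q \<noteq> r" "p \<noteq> r" for p q r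
    using hull_Int[OF that] that by (metis hull_inc inf.idem insertCI singletonD)
  have surj1: "\<exists>e. e edge_of P \<and> v \<in> e \<and> e \<inter> H = G" if "G \<in> {{x1}, {x2}, {x3}}" for G
  proof -
    have "G \<in> (\<lambda>F. F \<inter> H) ` {e. e edge_of P \<and> v \<in> e}"
      using that bij_betw_imp_surj_on[OF bij1] by (simp only: faces1)
    then show ?thesis by (elim imageE) auto
  qed
  have surj2: "\<exists>F. F \<in> two_faces P \<and> v \<in> F \<and> F \<inter> H = G"
    if "G \<in> {convex hull {x2, x3}, convex hull {x3, x1}, convex hull {x1, x2}}" for G
  proof -
    have "G \<in> (\<lambda>F. F \<inter> H) ` {F \<in> two_faces P. v \<in> F}"
      using that bij_betw_imp_surj_on[OF bij2] by (simp only: faces2)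
    then show ?thesis by (elim imageE) auto
  qed
  obtain e1 where e1: "e1 edge_of P" "v \<in> e1" "e1 \<inter> H = {x1}" using surj1[of "{x1}"] by blast
  obtain e2 where e2: "e2 edge_of P" "v \<in> e2" "e2 \<inter> H = {x2}" using surj1[of "{x2}"] by blast
  obtain e3 where e3: "e3 edge_of P" "v \<in> e3" "e3 \<inter> H = {x3}" using surj1[of "{x3}"] by blast
  obtain F1 where F1: "F1 \<in> two_faces P" "v \<in> F1" "F1 \<inter> H = convex hull {x2, x3}"
    using surj2[of "convex hull {x2, x3}"] by blast
  obtain F2 where F2: "F2 \<in> two_faces P" "v \<in> F2" "F2 \<inter> H = convex hull {x3, x1}"
    using surj2[of "convex hull {x3, x1}"] by blast
  obtain F3 where F3: "F3 \<in> two_faces P" "v \<in> F3" "F3 \<inter> H = convex hull {x1, x2}"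
    using surj2[of "convex hull {x1, x2}"] by blast
  have inj1: "e = e'" if "e edge_of P" "v \<in> e" "e' edge_of P" "v \<in> e'" "e \<inter> H = e' \<inter> H" for e e'
    using inj_onD[OF bij_betw_imp_inj_on[OF bij1] that(5)] that by simp
  have inj2: "F = F'" if "F \<in> two_faces P" "v \<in> F" "F' \<in> two_faces P" "v \<in> F'" "F \<inter> H = F' \<inter> H" for F F'
    using inj_onD[OF bij_betw_imp_inj_on[OF bij2] that(5)] that by simp
  have edges: "{e. e edge_of P \<and> v \<in> e} = {e1, e2, e3}"
  proof -
    have "e \<in> {e1, e2, e3}" if "e edge_of P" "v \<in> e" for e
    proof -
      have "e \<inter> H \<in> {{x1}, {x2}, {x3}}"
        using bij_betw_apply[OF bij1, of e] that unfolding faces1 by blast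
      then show ?thesis using inj1[of e] that e1 e2 e3 by auto
    qed
    then show ?thesis using e1 e2 e3 by blast
  qed
  have two: "{F \<in> two_faces P. v \<in> F} = {F1, F2, F3}"
  proof -
    have "F \<in> {F1, F2, F3}" if "F \<in> two_faces P" "v \<in> F" for F
    proof -
      have "F \<inter> H \<in> {convex hull {x2, x3}, convex hull {x3, x1}, convex hull {x1, x2}}"
        using bij_betw_apply[OF bij2, of F] that unfolding faces2 by blast
      then show ?thesis using inj2[of F] that F1 F2 F3 by auto
    qed
    then show ?thesis using F1 F2 F3 by blast
  qed
  \<comment> \<open>\<open>F \<inter> F'\<close> and \<open>e\<close> are faces through
    \<open>v\<close> with the same section, so \<open>face_H_mono\<close> gives both
    inclusions.\<close>
  have Int: "F \<inter> F' = e"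
    if F: "F \<in> two_faces P" "v \<in> F" "F' \<in> two_faces P" "v \<in> F'" and e: "e edge_of P" "v \<in> e"
      and eq: "(F \<inter> H) \<inter> (F' \<inter> H) = e \<inter> H" and x: "e \<inter> H = {x}" for F F' e x
  proof -
    have f: "F \<inter> F' face_of P" "v \<in> F \<inter> F'" "e face_of P"
      using F e by (auto simp: two_faces_def edge_of_def intro: face_of_Int)
    have xx: "x \<in> F \<inter> F'" "x \<in> e" "a \<bullet> x = b" using eq x by auto
    have "F \<inter> F' \<noteq> {v}" "e \<noteq> {v}" using face_meets_H(2)[OF f(1) xx(1,3)] face_meets_H(2)[OF f(3) xx(2,3)] .
    then show ?thesis
      using face_H_mono[OF f(1,2) _ f(3)] face_H_mono[OF f(3) e(2) _ f(1)] eq by blast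
  qed
  have X: "{x1, x3, x2} = X" "{x2, x1, x3} = X" "{x3, x2, x1} = X"
    unfolding x(1) by blast+
  have swap: "{x3, x1} = {x1, x3}" "{x2, x1} = {x1, x2}" "{x3, x2} = {x2, x3}" by blast+
  have "(F2 \<inter> H) \<inter> (F3 \<inter> H) = e1 \<inter> H"
    using hull_Int[OF X(1)] x by (simp only: F2(3) F3(3) e1(3) swap not_sym simp_thms)
  then have i1: "F2 \<inter> F3 = e1" by (rule Int[OF F2(1,2) F3(1,2) e1(1,2) _ e1(3)])
  have "(F3 \<inter> H) \<inter> (F1 \<inter> H) = e2 \<inter> H"
    using hull_Int[OF X(2)] x by (simp only: F3(3) F1(3) e2(3) swap not_sym simp_thms)
  then have i2: "F3 \<inter> F1 = e2" by (rule Int[OF F3(1,2) F1(1,2) e2(1,2) _ e2(3)])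
  have "(F1 \<inter> H) \<inter> (F2 \<inter> H) = e3 \<inter> H"
    using hull_Int[OF X(3)] x by (simp only: F1(3) F2(3) e3(3) swap not_sym simp_thms)
  then have i3: "F1 \<inter> F2 = e3" by (rule Int[OF F1(1,2) F2(1,2) e3(1,2) _ e3(3)])
  have ee: "e1 \<noteq> e2" "e2 \<noteq> e3" "e3 \<noteq> e1" using e1(3) e2(3) e3(3) x(2-) by auto
  have "F1 \<noteq> F2"  "F2 \<noteq> F3" "F3 \<noteq> F1"
    using ne[OF X(3)] ne[OF X(1)] ne[OF X(2)] x(2-) F1(3) F2(3) F3(3) unfolding swap by metis+
  then show ?thesis using that[OF edges ee two] i1 i2 i3 by blast
qed

section \<open>The boundary of a polygon\<close>

text \<open>The boundary of a polygon minus a vertex is homeomorphic to a line, hence connected.\<close>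

lemma polygon_minus_vertex_connected:
  assumes F: "polytope F" "aff_dim F = 2" and v: "v \<in> vertices F"
    and x: "x \<in> vertices F" "x \<noteq> v" and y: "y \<in> vertices F" "y \<noteq> v"
  shows "(x, y) \<in> {(p, q). adjacent F p q \<and> p \<noteq> v \<and> q \<noteq> v}\<^sup>*" (is "_ \<in> ?R\<^sup>*")
proof (rule ccontr)
  assume no: "(x, y) \<notin> ?R\<^sup>*"
  \<comment> \<open>The vertices reachable from x. If y is not among them, the closed sets
    \<open>A\<close> and \<open>B\<close>, formed by the edges that meet \<open>C\<close> and those
    that do not, disconnect the punctured boundary.\<close>
  define C where "C = {w \<in> vertices F. w \<noteq> v \<and> (x, w) \<in> ?R\<^sup>*}"
  define A where "A = \<Union> {e. e edge_of F \<and> e \<inter> C \<noteq> {}}"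
  define B where "B = \<Union> {e. e edge_of F \<and> e \<inter> C = {}}"
  have fin: "finite {e. e edge_of F}"
    using finite_polytope_faces[OF F(1)] by (rule rev_finite_subset) (auto simp: edge_of_def)
  have closed_edge: "closed e" if "e edge_of F" for e
    using that F(1) face_of_imp_closed polytope_imp_closed polytope_imp_convex unfolding edge_of_def by blast
  have closed: "closed A" "closed B"
    unfolding A_def B_def using fin closed_edge by (auto intro!: closed_Union)
  have rf: "rel_frontier F = \<Union> {e. e edge_of F}"
    unfolding rel_frontier_of_polyhedron[OF polytope_imp_polyhedron[OF F(1)]]
    using F(2) by (auto simp: facet_of_def edge_of_def)
  have edge_at: "\<exists>e. e edge_of F \<and> w \<in> e" if "w \<in> vertices F" for w
    using polygon_two_edges[OF F that] by (metis (mono_tags, lifting) card.empty empty_Collect_eq zero_neq_numeral)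
  have closedC: "q \<in> C" if e: "e edge_of F" and p: "p \<in> e" "p \<in> C" and q: "q \<in> e" "q \<in> vertices F" "q \<noteq> v" for e p q
  proof (cases "p = q")
    case False
    then have "adjacent F p q"
      using edge_eq_segment[OF F(1) e, of p q] p q e by (auto simp: C_def adjacent_def)
    then show ?thesis using p q by (auto simp: C_def intro: rtrancl_into_rtrancl)
  qed (use p in simp)
  have "connected (rel_frontier F - {v})"
  proof -
    \<comment> \<open>A punctured relative boundary is homeomorphic to any affine set of dimension
      one less than \<open>F\<close>; the line spanned by an edge is such a set.\<close>
    obtain e where e: "e edge_of F" "v \<in> e" using edge_at v by blast
    then have "rel_frontier F - {v} homeomorphic affine hull e"
      using F rf by (intro homeomorphic_punctured_sphere_affine_gen)
        (auto simp: polytope_imp_convex polytope_imp_bounded edge_of_def)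
    then show ?thesis
      using homeomorphic_connectedness convex_connected affine_imp_convex affine_affine_hull by blast
  qed
  moreover have "rel_frontier F - {v} \<subseteq> A \<union> B" unfolding rf A_def B_def by blast
  \<comment> \<open>An edge in \<open>A\<close> and an edge in \<open>B\<close> meet in at most one
    point, which is a vertex. Other than \<open>v\<close>, it would be reachable along the first
    edge and so put the second edge into \<open>A\<close>.\<close>
  moreover have "A \<inter> B \<inter> (rel_frontier F - {v}) = {}"
  proof -
    have False if e: "e edge_of F" "e \<inter> C \<noteq> {}" and e': "e' edge_of F" "e' \<inter> C = {}"
      and p: "p \<in> e" "p \<in> e'" "p \<noteq> v" for e e' p
    proof -
      have f: "e \<inter> e' face_of F" using e e' by (auto simp: edge_of_def intro: face_of_Int)
      then have "e \<inter> e' face_of e"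
        using e(1) by (auto simp: edge_of_def face_of_face)
      moreover have "e \<inter> e' \<noteq> e" using e e' by blast
      ultimately have "aff_dim (e \<inter> e') < 1"
        using e(1) face_of_aff_dim_lt[of e "e \<inter> e'"] face_of_imp_convex by (auto simp: edge_of_def)
      moreover have "e \<inter> e' \<noteq> {}" using p by blast
      ultimately have "aff_dim (e \<inter> e') = 0"
        using aff_dim_empty[of "e \<inter> e'"] aff_dim_geq[of "e \<inter> e'"] by simp
      then obtain z where "e \<inter> e' = {z}" unfolding aff_dim_eq_0 by blast
      moreover have "p \<in> e \<inter> e'" using p by simp
      ultimately have "e \<inter> e' = {p}" by simp
      then have "p \<in> vertices F" using f by (simp add: vertices_def face_of_singleton)
      then have "p \<in> C" using closedC[OF e(1)] e(2) p by blast
      then show False using e' p by blast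
    qed
    then show ?thesis unfolding A_def B_def by blast
  qed
  moreover have "x \<in> A \<inter> (rel_frontier F - {v})"
  proof -
    obtain e where "e edge_of F" "x \<in> e" using edge_at x by blast
    moreover have "x \<in> C" using x by (simp add: C_def)
    ultimately show ?thesis using x unfolding A_def rf by blast
  qed
  moreover have "y \<in> B \<inter> (rel_frontier F - {v})"
  proof -
    obtain e where e: "e edge_of F" "y \<in> e" using edge_at y by blast
    moreover have "y \<notin> C" using no by (simp add: C_def)
    then have "e \<inter> C = {}" using closedC[OF e(1) _ _ e(2)] y by blast
    ultimately show ?thesis using y unfolding B_def rf by blast
  qed
  ultimately show False
    using closed unfolding connected_closed by blast
qed

text \<open>Two edges contain \<open>v\<close>; each of the at most \<open>k\<close> others
  contributes its two orientations.\<close>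

lemma polygon_minus_vertex_card:
  assumes F: "polytope F" "aff_dim F = 2" and v: "v \<in> vertices F" and k: "num_edges F \<le> k + 2"
  shows "finite {(p, q). adjacent F p q \<and> p \<noteq> v \<and> q \<noteq> v}" (is "finite ?R")
    and "card {(p, q). adjacent F p q \<and> p \<noteq> v \<and> q \<noteq> v} \<le> 2 * k"
proof -
  define E where "E = {e. e edge_of F}"
  define E' where "E' = E - {e. e edge_of F \<and> v \<in> e}"
  have fin: "finite E"
    unfolding E_def using finite_polytope_faces[OF F(1)] by (rule rev_finite_subset) (auto simp: edge_of_def)
  have "card E' = card E - 2"
    unfolding E'_def using polygon_two_edges[OF F v] fin by (subst card_Diff_subset) (auto simp: E_def)
  then have cE': "card E' \<le> k" using k by (simp add: E_def num_edges_def)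
  define T where "T e = {(p, q). p \<in> vertices F \<inter> e \<and> q \<in> vertices F \<inter> e \<and> p \<noteq> q}" for e
  have T: "finite (T e) \<and> card (T e) \<le> 2" if e: "e \<in> E'" for e
  proof -
    obtain x y where xy: "vertices F \<inter> e = {x, y}"
      using edge_obtain_segment[OF F(1), of e] e unfolding E'_def E_def by blast
    then have sub: "T e \<subseteq> {(x, y), (y, x)}" by (auto simp: T_def)
    then show ?thesis using card_mono[OF _ sub] finite_subset[OF sub] card_insert_le_m1[of 2 "{(y, x)}" "(x, y)"]
      by (simp add: le_trans)
  qed
  have sub: "?R \<subseteq> (\<Union>e\<in>E'. T e)"
  proof clarify
    fix p q assume pq: "adjacent F p q" "p \<noteq> v" "q \<noteq> v"
    note D = adjacentD[OF F(1) pq(1)]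
    have "closed_segment p q \<in> E'"
      using pq D(2) v unfolding E'_def E_def adjacent_def by auto
    moreover have "(p, q) \<in> T (closed_segment p q)" using D by (auto simp: T_def)
    ultimately show "(p, q) \<in> (\<Union>e\<in>E'. T e)" by blast
  qed
  have finE': "finite E'" using fin by (simp add: E'_def)
  then show "finite ?R" using finite_subset[OF sub] T by blast
  have "card ?R \<le> card (\<Union>e\<in>E'. T e)" using finE' T by (intro card_mono sub) auto
  also have "\<dots> \<le> (\<Sum>e\<in>E'. card (T e))" using finE' by (rule card_UN_le)
  also have "\<dots> \<le> (\<Sum>e\<in>E'. 2)" using T by (intro sum_mono) blast
  also have "\<dots> \<le> 2 * k" using cE' by simp
  finally show "card ?R \<le> 2 * k" .
qed

section \<open>A curvature criterion\<close>

text \<open>The boundary of \<open>F\<close> away from \<open>v\<close> has at most \<open>k\<close>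
  unit edges in series between x and y, so it conducts at least as well as a single edge of
  conductance 1 / k.\<close>

lemma polygon_energy_lower_bound:
  assumes F: "polytope F" "aff_dim F = 2" and v: "v \<in> vertices F" and k: "num_edges F \<le> k + 2" "k \<ge> 1"
    and x: "x \<in> vertices F" "x \<noteq> v" and y: "y \<in> vertices F" "y \<noteq> v"
  shows "1 / k * (f x - f y)\<^sup>2
    \<le> (\<Sum>(p, q)\<in>{(p, q). adjacent F p q \<and> p \<noteq> v \<and> q \<noteq> v}. (f p - f q)\<^sup>2) / 2" (is "_ \<le> ?S")
proof -
  have "sym {(p, q). adjacent F p q \<and> p \<noteq> v \<and> q \<noteq> v}"
    using adjacent_sym by (auto simp: sym_def)
  then have "(f x - f y)\<^sup>2 \<le> k * ?S"
    by (rule connected_energy_lower_bound[OF polygon_minus_vertex_card(1)[OF F v k(1)] _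
        polygon_minus_vertex_connected[OF F v x y] polygon_minus_vertex_card(2)[OF F v k(1)]])
  then show ?thesis using k(2) by (simp add: field_simps)
qed

text \<open>Together, \<open>six\<close>, \<open>five\<close> and \<open>four\<close> say that the
  ordered edge numbers of the 2-faces at \<open>v\<close> are at most (6, 5, 4) entrywise.\<close>

lemma resistance_curvature_pos:
  fixes P :: "'a::euclidean_space set"
  assumes P: "polytope P" "aff_dim P = 3" and v: "v \<in> vertices P"
    and deg: "card {e. e edge_of P \<and> v \<in> e} \<le> 3"
    and six: "\<And>F. F \<in> two_faces P \<Longrightarrow> v \<in> F \<Longrightarrow> num_edges F \<le> 6"
    and five: "\<And>F G. F \<in> two_faces P \<Longrightarrow> v \<in> F \<Longrightarrow> G \<in> two_faces P \<Longrightarrow> v \<in> G \<Longrightarrow> F \<noteq> G \<Longrightarrow>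
      num_edges F \<le> 5 \<or> num_edges G \<le> 5"
    and four: "\<exists>F\<in>two_faces P. v \<in> F \<and> num_edges F \<le> 4"
  shows "resistance_curvature (vertices P) (adjacent P) v > 0"
proof -
  obtain e1 e2 e3 F1 F2 F3 where
    edges: "{e. e edge_of P \<and> v \<in> e} = {e1, e2, e3}" and e_ne: "e1 \<noteq> e2" "e2 \<noteq> e3" "e3 \<noteq> e1" and
    faces: "{F \<in> two_faces P. v \<in> F} = {F1, F2, F3}" and F_ne: "F1 \<noteq> F2" "F2 \<noteq> F3" "F3 \<noteq> F1" and
    Int: "F2 \<inter> F3 = e1" "F3 \<inter> F1 = e2" "F1 \<inter> F2 = e3"
    using P v deg by (rule vertex_structure)
  have e: "e1 edge_of P" "v \<in> e1" "e2 edge_of P" "v \<in> e2" "e3 edge_of P" "v \<in> e3"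
    using edges by blast+
  have F: "F1 \<in> two_faces P" "v \<in> F1" "F2 \<in> two_faces P" "v \<in> F2" "F3 \<in> two_faces P" "v \<in> F3"
    using faces by blast+
  obtain u1 where u1: "u1 \<in> vertices P" "adjacent P u1 v" "e1 = closed_segment u1 v"
    using edge_obtain_adjacent[OF P(1) e(1) v e(2)] .
  obtain u2 where u2: "u2 \<in> vertices P" "adjacent P u2 v" "e2 = closed_segment u2 v"
    using edge_obtain_adjacent[OF P(1) e(3) v e(4)] .
  obtain u3 where u3: "u3 \<in> vertices P" "adjacent P u3 v" "e3 = closed_segment u3 v"
    using edge_obtain_adjacent[OF P(1) e(5) v e(6)] .
  have u_ne: "u1 \<noteq> u2" "u2 \<noteq> u3" "u3 \<noteq> u1" using e_ne u1 u2 u3 by blast+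
  have u_v: "u1 \<noteq> v" "u2 \<noteq> v" "u3 \<noteq> v" using adjacentD(1)[OF P(1)] u1 u2 u3 by blast+
  have nbrs: "{u \<in> vertices P. adjacent P u v} = {u1, u2, u3}"
  proof
    show "{u1, u2, u3} \<subseteq> {u \<in> vertices P. adjacent P u v}" using u1 u2 u3 by blast
    show "{u \<in> vertices P. adjacent P u v} \<subseteq> {u1, u2, u3}"
    proof
      fix u assume u: "u \<in> {u \<in> vertices P. adjacent P u v}"
      then have "closed_segment u v \<in> {e1, e2, e3}" unfolding edges[symmetric] by (auto simp: adjacent_def)
      then obtain w where w: "w \<in> {u1, u2, u3}" "closed_segment u v = closed_segment w v"
        using u1(3) u2(3) u3(3) by blast
      then have "w \<in> {u \<in> vertices P. adjacent P u v}" using u1 u2 u3 by blast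
      then have "u = w"
        using inj_onD[OF bij_betw_imp_inj_on[OF bij_betw_neighbours_edges[OF P(1) v]] w(2) u] by blast
      then show "u \<in> {u1, u2, u3}" using w by blast
    qed
  qed
  \<comment> \<open>The number of edges of \<open>F\<close> that miss \<open>v\<close>. The maximum
    makes it positive without a lower bound on \<open>num_edges F\<close>.\<close>
  define k where "k F = max 1 (num_edges F - 2)" for F :: "'a set"
  have bound: "num_edges F \<le> k F + 2 \<and> k F \<ge> 1" for F :: "'a set"
    by (auto simp: k_def)
  define R where "R F = {(p, q). adjacent F p q \<and> p \<noteq> v \<and> q \<noteq> v}" for F
  define Sp where "Sp = {(u1, v), (v, u1), (u2, v), (v, u2), (u3, v), (v, u3)}"
  define A where "A = {(p, q). p \<in> vertices P \<and> q \<in> vertices P \<and> adjacent P p q}"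
  have fin: "finite (vertices P)" using P(1) by (rule finite_vertices)
  have finA: "finite A" unfolding A_def by (rule finite_subset[of _ "vertices P \<times> vertices P"]) (use fin in auto)
  have R_sub: "adjacent P p q \<and> p \<in> vertices P \<and> q \<in> vertices P \<and> p \<in> F \<and> q \<in> F \<and> p \<noteq> v \<and> q \<noteq> v"
    if "(p, q) \<in> R F" "F \<in> two_faces P" for p q F
  proof -
    have f: "F face_of P" using that(2) by (simp add: two_faces_def)
    have pq: "closed_segment p q edge_of F" "p \<noteq> v" "q \<noteq> v" using that(1) by (auto simp: R_def adjacent_def)
    then have "closed_segment p q edge_of P" "closed_segment p q \<subseteq> F"
      using face_of_trans[OF _ f] face_of_imp_subset unfolding edge_of_def by blast+
    then have "adjacent P p q" "p \<in> F" "q \<in> F" by (auto simp: adjacent_def)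
    then show ?thesis using adjacentD(2)[OF P(1), of p q] pq by blast
  qed
  \<comment> \<open>Two 2-faces at \<open>v\<close> share only an edge
    \<open>closed_segment u v\<close>, whose single vertex other than \<open>v\<close> is
    \<open>u\<close>; a common arc would have both ends at \<open>u\<close>.\<close>
  have R_disj: "R F \<inter> R F' = {}"
    if "F \<in> two_faces P" "F' \<in> two_faces P" "F \<inter> F' = closed_segment u v" "adjacent P u v" for F F' u
  proof -
    have False if pq: "(p, q) \<in> R F" "(p, q) \<in> R F'" for p q
    proof -
      note 1 = R_sub[OF pq(1) \<open>F \<in> two_faces P\<close>] and 2 = R_sub[OF pq(2) \<open>F' \<in> two_faces P\<close>]
      have "p \<in> vertices P \<inter> closed_segment u v" "q \<in> vertices P \<inter> closed_segment u v"
        using 1 2 \<open>F \<inter> F' = closed_segment u v\<close> by blast+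
      then have "p = u" "q = u" using adjacentD(2)[OF P(1) \<open>adjacent P u v\<close>] 1 by auto
      then show False using 1 adjacentD(1)[OF P(1)] by blast
    qed
    then show ?thesis by auto
  qed
  have disj: "R F2 \<inter> R F3 = {}" "R F3 \<inter> R F1 = {}" "R F1 \<inter> R F2 = {}"
    using R_disj[OF F(3,5), of u1] R_disj[OF F(5,1), of u2] R_disj[OF F(1,3), of u3] Int u1 u2 u3 by simp_all
  have dSp: "Sp \<inter> R F = {}" for F unfolding Sp_def R_def by auto
  have subA: "Sp \<union> (R F1 \<union> (R F2 \<union> R F3)) \<subseteq> A"
    using R_sub F u1 u2 u3 v adjacent_sym unfolding A_def Sp_def by blast
  \<comment> \<open>Rayleigh monotonicity: only the spokes and the three arcs are kept. The arc in
    \<open>F3\<close> joins \<open>u1\<close> to \<open>u2\<close>, the one in \<open>F1\<close>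
    joins \<open>u2\<close> to \<open>u3\<close>, and the one in \<open>F2\<close> joins
    \<open>u3\<close> to \<open>u1\<close>, which fixes the order of the conductances.\<close>
  have quad: "wheel_form (1 / k F3) (1 / k F1) (1 / k F2) (f u1 - f v) (f u2 - f v) (f u3 - f v)
      \<le> quad_form (vertices P) (adjacent P) f" for f
  proof -
    define g where "g = (\<lambda>(p, q). (f p - f q)\<^sup>2)"
    have fP: "polytope F \<and> aff_dim F = 2 \<and> F face_of P" if "F \<in> two_faces P" for F
      using that face_of_polytope_polytope[OF P(1)] by (auto simp: two_faces_def)
    have arc: "1 / k F * (f p - f q)\<^sup>2 \<le> sum g (R F) / 2"
      if "F \<in> two_faces P" "v \<in> F" "p \<in> vertices P" "p \<in> F" "p \<noteq> v" "q \<in> vertices P" "q \<in> F" "q \<noteq> v" for F p q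
      unfolding g_def R_def
      using fP[OF that(1)] bound[of F] that v vertices_face[of F P]
      by (intro polygon_energy_lower_bound) auto
    have mem: "u1 \<in> F2" "u1 \<in> F3" "u2 \<in> F3" "u2 \<in> F1" "u3 \<in> F1" "u3 \<in> F2"
      using Int u1(3) u2(3) u3(3) by auto
    have 1: "sum g (Sp \<union> (R F1 \<union> (R F2 \<union> R F3))) = sum g Sp + (sum g (R F1) + (sum g (R F2) + sum g (R F3)))"
    proof -
      have "finite Sp" "finite (R F1)" "finite (R F2)" "finite (R F3)"
        using finite_subset[OF subA finA] by simp_all
      moreover have "Sp \<inter> (R F1 \<union> (R F2 \<union> R F3)) = {}" "R F1 \<inter> (R F2 \<union> R F3) = {}"
        using disj dSp by blast+
      ultimately show ?thesis using disj(1) by (simp add: sum.union_disjoint)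
    qed
    have 2: "sum g Sp = 2 * ((f u1 - f v)\<^sup>2 + (f u2 - f v)\<^sup>2 + (f u3 - f v)\<^sup>2)"
      using u_ne u_v unfolding Sp_def by (simp add: g_def power2_commute[of "f v"])
    have diff: "f p - f v - (f q - f v) = f p - f q" for p q by simp
    have "sum g (Sp \<union> (R F1 \<union> (R F2 \<union> R F3))) \<le> sum g A"
      using finA subA by (intro sum_mono2) (auto simp: g_def)
    moreover have "sum g A / 2 = quad_form (vertices P) (adjacent P) f"
    proof -
      have "sum g A = (\<Sum>z\<in>vertices P \<times> vertices P. case z of (p, q) \<Rightarrow> if adjacent P p q then (f p - f q)\<^sup>2 else 0)"
        using fin by (intro sum.mono_neutral_cong_left) (auto simp: A_def g_def split: if_splits)
      then show ?thesis by (simp add: quad_form_def sum.cartesian_product)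
    qed
    moreover have "w + x3 + x1 + x2 \<le> q"
      if "T \<le> A" "A / 2 = q" "T = S + (r1 + (r2 + r3))" "S = 2 * w" "x1 \<le> r1 / 2" "x2 \<le> r2 / 2" "x3 \<le> r3 / 2"
      for w x1 x2 x3 q T A S r1 r2 r3 :: real
      using that by linarith
    ultimately show ?thesis
      unfolding wheel_form_def diff using 1 2 arc[OF F(1,2) u2(1) mem(4) u_v(2) u3(1) mem(5) u_v(3)]
        arc[OF F(3,4) u3(1) mem(6) u_v(3) u1(1) mem(1) u_v(1)]
        arc[OF F(5,6) u1(1) mem(2) u_v(1) u2(1) mem(3) u_v(2)]
      by blast
  qed
  have k: "k F1 \<ge> 1" "k F2 \<ge> 1" "k F3 \<ge> 1" using bound by blast+
  have "k F1 * k F2 * k F3 < 3 * (k F1 + k F2 + k F3)"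
  proof -
    have "k F1 \<le> 4" "k F2 \<le> 4" "k F3 \<le> 4"
      using six[OF F(1,2)] six[OF F(3,4)] six[OF F(5,6)] by (auto simp: k_def)
    moreover have "k F1 \<le> 3 \<or> k F2 \<le> 3" "k F2 \<le> 3 \<or> k F3 \<le> 3" "k F3 \<le> 3 \<or> k F1 \<le> 3"
      using five[OF F(1-4) F_ne(1)] five[OF F(3-6) F_ne(2)] five[OF F(5,6,1,2) F_ne(3)]
      by (auto simp: k_def)
    moreover have "k F1 \<le> 2 \<or> k F2 \<le> 2 \<or> k F3 \<le> 2"
    proof -
      obtain G where "G \<in> {F1, F2, F3}" "num_edges G \<le> 4"
        using four unfolding faces[symmetric] by blast
      then show ?thesis by (auto simp: k_def)
    qed
    \<comment> \<open>Only finitely many triples remain, all dominated by a permutation of (4, 3,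
      2).\<close>
    moreover have "k F1 \<in> {1, 2, 3, 4}" "k F2 \<in> {1, 2, 3, 4}" "k F3 \<in> {1, 2, 3, 4}"
      using calculation(1-3) k by auto
    ultimately show ?thesis by (elim insertE) simp_all
  qed
  then have "real (k F1 * k F2 * k F3) < real (3 * (k F1 + k F2 + k F3))"
    by (simp only: of_nat_less_iff)
  then have "real (k F1) * real (k F2) * real (k F3) < 3 * (real (k F1) + real (k F2) + real (k F3))"
    by simp
  \<comment> \<open>Division by three times the product of the arc lengths gives the condition on
    the pairwise products of conductances.\<close>
  then have "1 / 3 < 1 / real (k F3) * (1 / real (k F1)) + 1 / real (k F1) * (1 / real (k F2)) + 1 / real (k F2) * (1 / real (k F3))"
    using k by (simp add: field_simps)
  then show ?thesis
    using resistance_curvature_pos_of_wheel[OF fin _ nbrs v u_ne _ _ _ quad] adjacent_sym by auto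
qed

section \<open>Truncation of a vertex\<close>

context vertex_cut
begin

lemma vertex_cut_face:
  assumes "F face_of P" "v \<in> F"
  shows "vertex_cut F v a b"
proof
  show "polytope F" using polytope assms(1) by (rule face_of_polytope_polytope)
  show "v \<in> vertices F" using vertex assms(2) vertices_face[OF assms(1)] by simp
  show "a \<bullet> w < b" if "w \<in> vertices F" "w \<noteq> v" for w
    using below[of w] that vertices_face[OF assms(1)] by simp
qed (rule above)

text \<open>Look at a relative interior point of \<open>G\<close>. If it is on the hyperplane,
  \<open>G\<close> lies in the cutting face and is a section of a face through \<open>v\<close>. If
  it is strictly below, the half-space contains a neighborhood of it, so \<open>G\<close> is the
  trimmed copy of the face of \<open>P\<close> around that point and keeps its dimension.\<close>

lemma face_of_truncation_cases:
  assumes G: "G face_of P \<inter> L" "G \<noteq> {}"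
  obtains (hyperplane) F where "F face_of P" "v \<in> F" "G = F \<inter> H" "aff_dim F = aff_dim G + 1"
  | (halfspace) F where "F face_of P" "G = F \<inter> L" "aff_dim F = aff_dim G"
proof -
  have "convex G" using G face_of_imp_convex by blast
  then obtain x where x: "x \<in> rel_interior G" using G rel_interior_eq_empty by blast
  have xP: "x \<in> P" "a \<bullet> x \<le> b" using x rel_interior_subset face_of_imp_subset[OF G(1)] by blast+
  show ?thesis
  proof (cases "a \<bullet> x = b")
    case True
    have PH: "P \<inter> H face_of P \<inter> L"
      by (intro face_of_Int_Int face_of_refl polytope_imp_convex polytope hyperplane_face_of_halfspace_le)
    have "G \<subseteq> P \<inter> H"
      using subset_of_face_of[OF PH face_of_imp_subset[OF G(1)]] x xP True by blast
    then have "G face_of P \<inter> H"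
      using face_of_face[OF PH, of G] G by blast
    then obtain F where F: "F face_of P" "v \<in> F" "F \<noteq> {v}" "G = F \<inter> H"
      using G(2) face_of_slice_cases by blast
    then show ?thesis using aff_dim_Int_H hyperplane by fastforce
  next
    case False
    obtain F where F: "F face_of P" "x \<in> rel_interior F"
      using polytope xP polytope_obtain_face_rel_interior by blast
    have cF: "convex F" using F face_of_imp_convex by blast
    have anz: "a \<noteq> 0" using above below xP False by auto
    have xL: "x \<in> interior L" using xP False anz by (simp add: interior_halfspace_le)
    then have xL': "x \<in> rel_interior L" using interior_subset_rel_interior by blast
    have "rel_interior (F \<inter> L) = rel_interior F \<inter> rel_interior L"
      using cF F(2) xL' by (intro convex_rel_interior_inter_two convex_halfspace_le) auto
    then have "x \<in> rel_interior (F \<inter> L)" using F(2) xL' by blast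
    then have eq: "G = F \<inter> L"
      using F(1) G(1) x by (intro face_of_Int_eq convex_halfspace_le)
    have "F \<inter> interior L \<noteq> {}" using xL F(2) rel_interior_subset by blast
    then have "aff_dim G = aff_dim F"
      unfolding eq by (rule aff_dim_convex_Int_nonempty_interior[OF cF])
    then show ?thesis using F(1) eq halfspace by simp
  qed
qed

lemma face_Int_L:
  assumes "F face_of P" "v \<notin> F"
  shows "F \<inter> L = F"
  using face_below[OF assms] by auto

lemma polytope_truncation: "polytope (P \<inter> L)"
  by (rule polytope_Int_polyhedron[OF polytope polyhedron_halfspace_le])

lemma aff_dim_face_Int_L:
  assumes "F face_of P" "F \<noteq> {}" "F \<noteq> {v}"
  shows "aff_dim (F \<inter> L) = aff_dim F"
proof -
  obtain w where w: "w \<in> F" "a \<bullet> w < b" using face_obtain_below[OF assms] below by blast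
  then have "a \<noteq> 0" using above by auto
  then have "w \<in> F \<inter> interior L" using w by (simp add: interior_halfspace_le)
  then show ?thesis using assms face_of_imp_convex by (intro aff_dim_convex_Int_nonempty_interior) auto
qed

section \<open>Edges and 2-faces of the truncation\<close>

lemma finite_edges: "finite {e. e edge_of P}"
  using finite_polytope_faces[OF polytope] by (rule rev_finite_subset) (auto simp: edge_of_def)

lemma finite_two_faces: "finite (two_faces P)"
  using finite_polytope_faces[OF polytope] by (rule rev_finite_subset) (auto simp: two_faces_def)

lemma edge_of_truncation_cases:
  assumes "e edge_of P \<inter> L"
  obtains (hyperplane) F where "F \<in> two_faces P" "v \<in> F" "e = F \<inter> H"
  | (halfspace) e' where "e' edge_of P" "e = e' \<inter> L"
proof -
  have e: "e face_of P \<inter> L" "aff_dim e = 1" using assms by (auto simp: edge_of_def)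
  then have "e \<noteq> {}" by auto
  from face_of_truncation_cases[OF e(1) this] show ?thesis
    using e(2) hyperplane halfspace by cases (auto simp: edge_of_def two_faces_def)
qed

text \<open>Besides the new edge \<open>P \<inter> H\<close>, every edge of the truncated polygon is
  a trimmed old edge.\<close>

lemma num_edges_polygon_truncation:
  assumes dim: "aff_dim P = 2"
  shows "num_edges (P \<inter> L) \<le> num_edges P + 1"
proof -
  have "{e. e edge_of P \<inter> L} \<subseteq> insert (P \<inter> H) ((\<lambda>e. e \<inter> L) ` {e. e edge_of P})"
  proof
    fix e assume "e \<in> {e. e edge_of P \<inter> L}"
    then have "e edge_of P \<inter> L" by simp
    then show "e \<in> insert (P \<inter> H) ((\<lambda>e. e \<inter> L) ` {e. e edge_of P})"
    proof (cases rule: edge_of_truncation_cases)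
      case (hyperplane F)
      then have "F = P"
        using face_of_aff_dim_lt[of P F] dim polytope polytope_imp_convex by (force simp: two_faces_def)
      then show ?thesis using hyperplane by simp
    qed auto
  qed
  then have "num_edges (P \<inter> L) \<le> card (insert (P \<inter> H) ((\<lambda>e. e \<inter> L) ` {e. e edge_of P}))"
    unfolding num_edges_def using finite_edges by (intro card_mono) auto
  also have "\<dots> \<le> Suc (card ((\<lambda>e. e \<inter> L) ` {e. e edge_of P}))"
    using finite_edges by (intro card_insert_le_m1) auto
  also have "\<dots> \<le> num_edges P + 1"
    unfolding num_edges_def using finite_edges by (simp add: card_image_le)
  finally show ?thesis .
qed

text \<open>For a 2-face through \<open>v\<close>, the hyperplane is also a vertex cut of that
  polygon; a face missing \<open>v\<close> is left unchanged.\<close>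

lemma num_edges_truncated_face:
  assumes F: "F \<in> two_faces P"
  shows "num_edges (F \<inter> L) \<le> (if v \<in> F then num_edges F + 1 else num_edges F)"
proof (cases "v \<in> F")
  case True
  interpret F: vertex_cut F v a b
    using F True by (intro vertex_cut_face) (auto simp: two_faces_def)
  show ?thesis using F.num_edges_polygon_truncation F True by (simp add: two_faces_def)
next
  case False
  then show ?thesis using F face_Int_L by (simp add: two_faces_def)
qed

text \<open>Shows the new 2-face to be a triangle when three 2-faces meet at
  \<open>v\<close>.\<close>

lemma num_edges_slice: "num_edges (P \<inter> H) = card {F \<in> two_faces P. v \<in> F}"
proof -
  have "{F. F face_of P \<and> aff_dim F = 1 + 1 \<and> v \<in> F} = {F \<in> two_faces P. v \<in> F}"
    by (auto simp: two_faces_def)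
  then show ?thesis
    using bij_betw_same_card[OF slice_bij[of 1]] by (simp add: num_edges_def edge_of_def)
qed

lemma two_face_of_truncation_cases:
  assumes dim: "aff_dim P = 3" and G: "G \<in> two_faces (P \<inter> L)"
  obtains (hyperplane) "G = P \<inter> H" | (halfspace) F where "F \<in> two_faces P" "G = F \<inter> L"
proof -
  have e: "G face_of P \<inter> L" "aff_dim G = 2" using G by (auto simp: two_faces_def)
  then have "G \<noteq> {}" by auto
  with e(1) show ?thesis
  proof (cases rule: face_of_truncation_cases)
    case (hyperplane F)
    then have "F = P"
      using face_of_aff_dim_lt[of P F] dim e polytope polytope_imp_convex by force
    then show ?thesis using hyperplane that by simp
  next
    case (halfspace F)
    then show ?thesis using that e by (auto simp: two_faces_def)
  qed
qed

lemma slice_two_face: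
  assumes "aff_dim P = 3"
  shows "P \<inter> H \<in> two_faces (P \<inter> L)"
proof -
  have "P face_of P" using polytope by (simp add: face_of_refl polytope_imp_convex)
  moreover have "v \<in> P" using vertex by (simp add: vertices_def extreme_point_of_def)
  moreover have "P \<noteq> {v}" using assms by auto
  ultimately have "aff_dim (P \<inter> H) = 2" using aff_dim_Int_H assms by simp
  moreover have "P \<inter> H face_of P \<inter> L"
    by (intro face_of_Int_Int face_of_refl polytope_imp_convex polytope hyperplane_face_of_halfspace_le)
  ultimately show ?thesis by (simp add: two_faces_def)
qed

lemma two_face_truncation:
  assumes "F \<in> two_faces P"
  shows "F \<inter> L \<in> two_faces (P \<inter> L)"
proof -
  have F: "F face_of P" "aff_dim F = 2" using assms by (auto simp: two_faces_def)
  then have "F \<noteq> {}" "F \<noteq> {v}" by auto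
  then show ?thesis
    using F aff_dim_face_Int_L[OF F(1)] by (simp add: two_faces_def face_of_slice convex_halfspace_le)
qed

section \<open>Vertices of the truncation and their degrees\<close>

lemma vertex_of_truncation_cases:
  assumes "x \<in> vertices (P \<inter> L)"
  obtains (old) "x \<in> vertices P" "a \<bullet> x < b"
  | (new) e where "e edge_of P" "v \<in> e" "e \<inter> H = {x}"
proof -
  have x: "{x} face_of P \<inter> L" using assms by (simp add: vertices_def face_of_singleton)
  have xL: "a \<bullet> x \<le> b" using face_of_imp_subset[OF x] by simp
  have "{x} \<noteq> {}" by simp
  with x show ?thesis
  proof (cases rule: face_of_truncation_cases)
    case (hyperplane F)
    show ?thesis
    proof (rule new)
      have "aff_dim F = 1" using hyperplane(4) by simp
      then show "F edge_of P" using hyperplane(1) by (simp add: edge_of_def)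
    qed (use hyperplane in auto)
  next
    case (halfspace F)
    have "aff_dim F = 0" using halfspace(3) by simp
    then obtain y where "F = {y}" unfolding aff_dim_eq_0 by blast
    moreover have "x \<in> F" using halfspace(2) by blast
    ultimately have "F = {x}" by simp
    then have "x \<in> vertices P" using halfspace(1) by (simp add: vertices_def face_of_singleton)
    moreover have "x \<noteq> v" using xL above by auto
    ultimately show ?thesis using below by (intro old)
  qed
qed

text \<open>The edges inside the hyperplane avoid x, so every edge at x is a trimmed old
  edge.\<close>

lemma old_vertex_degree:
  assumes "a \<bullet> x < b"
  shows "card {e. e edge_of P \<inter> L \<and> x \<in> e} \<le> card {e. e edge_of P \<and> x \<in> e}"
proof -
  have fin: "finite {e. e edge_of P \<and> x \<in> e}" using finite_edges by simp
  have sub: "{e. e edge_of P \<inter> L \<and> x \<in> e} \<subseteq> (\<lambda>e. e \<inter> L) ` {e. e edge_of P \<and> x \<in> e}"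
  proof safe
    fix e assume e: "e edge_of P \<inter> L" "x \<in> e"
    from e(1) show "e \<in> (\<lambda>e. e \<inter> L) ` {e. e edge_of P \<and> x \<in> e}"
    proof (cases rule: edge_of_truncation_cases)
      case (hyperplane F)
      then show ?thesis using e assms by auto
    next
      case (halfspace e')
      then show ?thesis using e by auto
    qed
  qed
  then have "card {e. e edge_of P \<inter> L \<and> x \<in> e} \<le> card ((\<lambda>e. e \<inter> L) ` {e. e edge_of P \<and> x \<in> e})"
    using fin by (intro card_mono[OF _ sub]) auto
  also have "\<dots> \<le> card {e. e edge_of P \<and> x \<in> e}" using fin by (rule card_image_le)
  finally show ?thesis .
qed

text \<open>The point x is the whole section of \<open>e\<close>, so a face through x contains the
  section and hence \<open>e\<close>.\<close>

lemma edge_subset_of_meets: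
  assumes e: "e edge_of P" "v \<in> e" "e \<inter> H = {x}" and F: "F face_of P" "x \<in> F"
  shows "e \<subseteq> F"
proof -
  have "e \<noteq> {v}" using e by (auto simp: edge_of_def)
  moreover have "e face_of P" using e(1) by (simp add: edge_of_def)
  ultimately show ?thesis using face_H_mono[of e F] e F by simp
qed

text \<open>The edges at x are the remainder of \<open>e\<close> and, for the 2-faces
  \<open>F\<close> containing \<open>e\<close>, the sections \<open>F \<inter> H\<close>. Any other
  old edge through x would contain \<open>e\<close> and thus equal it.\<close>

lemma new_vertex_degree:
  assumes e: "e edge_of P" "v \<in> e" "e \<inter> H = {x}"
  shows "card {e'. e' edge_of P \<inter> L \<and> x \<in> e'} \<le> card {F \<in> two_faces P. e \<subseteq> F} + 1"
proof -
  have fin: "finite {F \<in> two_faces P. e \<subseteq> F}" using finite_two_faces by simp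
  have sub: "{e'. e' edge_of P \<inter> L \<and> x \<in> e'} \<subseteq> insert (e \<inter> L) ((\<lambda>F. F \<inter> H) ` {F \<in> two_faces P. e \<subseteq> F})"
  proof
    fix e' assume "e' \<in> {e'. e' edge_of P \<inter> L \<and> x \<in> e'}"
    then have e': "e' edge_of P \<inter> L" "x \<in> e'" by simp_all
    from e'(1) show "e' \<in> insert (e \<inter> L) ((\<lambda>F. F \<inter> H) ` {F \<in> two_faces P. e \<subseteq> F})"
    proof (cases rule: edge_of_truncation_cases)
      case (hyperplane F)
      then have "e \<subseteq> F" using e' by (intro edge_subset_of_meets[OF e]) (auto simp: two_faces_def)
      then show ?thesis using hyperplane by blast
    next
      case (halfspace e'')
      then have "e \<subseteq> e''" using e' edge_subset_of_meets[OF e, of e''] by (auto simp: edge_of_def)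
      moreover have "e face_of e''"
        using e(1) halfspace \<open>e \<subseteq> e''\<close> by (auto simp: edge_of_def face_of_face)
      moreover have "convex e''" "aff_dim e'' = aff_dim e"
        using halfspace e(1) face_of_imp_convex by (auto simp: edge_of_def)
      ultimately have "e = e''"
        using face_of_aff_dim_lt[of e'' e] by auto
      then show ?thesis using halfspace by simp
    qed
  qed
  then have "card {e'. e' edge_of P \<inter> L \<and> x \<in> e'} \<le> card (insert (e \<inter> L) ((\<lambda>F. F \<inter> H) ` {F \<in> two_faces P. e \<subseteq> F}))"
    using fin by (intro card_mono[OF _ sub]) auto
  also have "\<dots> \<le> Suc (card ((\<lambda>F. F \<inter> H) ` {F \<in> two_faces P. e \<subseteq> F}))"
    using fin by (intro card_insert_le_m1) auto
  also have "\<dots> \<le> card {F \<in> two_faces P. e \<subseteq> F} + 1"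
    using fin by (simp add: card_image_le)
  finally show ?thesis .
qed

end

section \<open>The expansion\<close>

lemma simple_3_polytope_degree:
  assumes "simple_3_polytope P" "v \<in> vertices P"
  shows "card {e. e edge_of P \<and> v \<in> e} = 3"
  using assms bij_betw_same_card[OF bij_betw_neighbours_edges[of P v]] by (simp add: simple_3_polytope_def)

lemma simple_3_polytope_incidence:
  assumes "simple_3_polytope P" "v \<in> vertices P"
  obtains e1 e2 e3 F1 F2 F3 where
    "{e. e edge_of P \<and> v \<in> e} = {e1, e2, e3}" "e1 \<noteq> e2" "e2 \<noteq> e3" "e3 \<noteq> e1"
    "{F \<in> two_faces P. v \<in> F} = {F1, F2, F3}" "F1 \<noteq> F2" "F2 \<noteq> F3" "F3 \<noteq> F1"
    "F2 \<inter> F3 = e1" "F3 \<inter> F1 = e2" "F1 \<inter> F2 = e3"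
proof -
  have P: "polytope P" "aff_dim P = 3" using assms(1) by (auto simp: simple_3_polytope_def)
  have deg: "card {e. e edge_of P \<and> v \<in> e} \<le> 3" using simple_3_polytope_degree[OF assms] by simp
  show ?thesis by (rule vertex_structure[OF P assms(2) deg]) (rule that)
qed

section \<open>Reading the vector of edge numbers\<close>

lemma ell_eq:
  assumes "{F \<in> two_faces P. v \<in> F} = {F1, F2, F3}" "F1 \<noteq> F2" "F2 \<noteq> F3" "F3 \<noteq> F1"
  shows "ell P v = rev (sorted_list_of_multiset {#num_edges F1, num_edges F2, num_edges F3#})"
  using assms(2-4) unfolding ell_def assms(1) by (simp add: eq_commute)

lemma set_ell:
  assumes "{F \<in> two_faces P. v \<in> F} = {F1, F2, F3}" "F1 \<noteq> F2" "F2 \<noteq> F3" "F3 \<noteq> F1"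
  shows "set (ell P v) = {num_edges F1, num_edges F2, num_edges F3}"
  by (simp only: ell_eq[OF assms] set_rev set_sorted_list_of_multiset) auto

lemma count_ell:
  assumes "{F \<in> two_faces P. v \<in> F} = {F1, F2, F3}" "F1 \<noteq> F2" "F2 \<noteq> F3" "F3 \<noteq> F1"
  shows "count_list (ell P v) n = count {#num_edges F1, num_edges F2, num_edges F3#} n"
  by (simp only: ell_eq[OF assms] count_mset[symmetric] mset_rev mset_sorted_list_of_multiset)

theorem theorem3p5:
  fixes P Q :: "'a::euclidean_space set" and v\<^sub>0 :: 'a
  assumes "simple_3_polytope P"
    and "\<forall>v\<in>vertices P. set (ell P v) \<subseteq> {3, 4, 5}"
    and "\<forall>v\<in>vertices P. ell P v \<noteq> [5, 5, 5]"
    and "v\<^sub>0 \<in> vertices P"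
    and "count_list (ell P v\<^sub>0) 5 \<le> 1"
    and "\<forall>u\<in>vertices P. adjacent P u v\<^sub>0 \<longrightarrow>
           (\<forall>F\<in>two_faces P. u \<in> F \<and> v\<^sub>0 \<notin> F \<longrightarrow> num_edges F \<le> 4)"
    and "\<forall>F\<in>two_faces P. v\<^sub>0 \<in> F \<longrightarrow> (\<forall>w\<in>vertices P. w \<in> F \<longrightarrow> ell P w \<noteq> [5, 5, 4])"
    and "delta_expansion P v\<^sub>0 Q"
  shows "resistance_positive Q"
proof -
  note P = assms(1) and range = assms(2) and no555 = assms(3) and v0 = assms(4) and one5 = assms(5)
    and opposite = assms(6) and no554 = assms(7)
  have poly: "polytope P" and dim: "aff_dim P = 3" using P by (auto simp: simple_3_polytope_def)
  obtain a b where ab: "a \<bullet> v\<^sub>0 > b" "\<forall>w\<in>vertices P - {v\<^sub>0}. a \<bullet> w < b" and Q: "Q = P \<inter> {x. a \<bullet> x \<le> b}"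
    using assms(8) by (auto simp: delta_expansion_def)
  interpret vertex_cut P v\<^sub>0 a b
    using poly v0 ab by unfold_locales auto
  have faceP: "P face_of P" using poly by (simp add: face_of_refl polytope_imp_convex)
  have polyQ: "polytope Q" unfolding Q by (rule polytope_truncation)
  have dimQ: "aff_dim Q = 3"
  proof -
    have "P \<noteq> {}" "P \<noteq> {v\<^sub>0}" using dim by auto
    then show ?thesis unfolding Q using aff_dim_face_Int_L[OF faceP] dim by simp
  qed
  have le5: "num_edges F \<in> {3, 4, 5}" if v: "v \<in> vertices P" and F: "F \<in> two_faces P" "v \<in> F" for v F
  proof -
    obtain F1 F2 F3 where A: "{F \<in> two_faces P. v \<in> F} = {F1, F2, F3}" "F1 \<noteq> F2" "F2 \<noteq> F3" "F3 \<noteq> F1"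
      by (rule simple_3_polytope_incidence[OF P v])
    have "F \<in> {F1, F2, F3}" using A(1) F by blast
    then have "num_edges F \<in> set (ell P v)" unfolding set_ell[OF A] by auto
    then show ?thesis using range v by blast
  qed
  \<comment> \<open>Two distinct pentagons at \<open>v\<^sub>0\<close> would give the entry 5
    multiplicity at least two in \<open>ell P v\<^sub>0\<close>.\<close>
  have not_both_5: "num_edges F \<le> 4 \<or> num_edges F' \<le> 4"
    if F: "F \<in> two_faces P" "v\<^sub>0 \<in> F" "F' \<in> two_faces P" "v\<^sub>0 \<in> F'" "F \<noteq> F'" for F F'
  proof (rule ccontr)
    assume "\<not> ?thesis"
    then have 5: "num_edges F = 5" "num_edges F' = 5"
      using le5[OF v0 F(1,2)] le5[OF v0 F(3,4)] by auto
    obtain F1 F2 F3 where A: "{F \<in> two_faces P. v\<^sub>0 \<in> F} = {F1, F2, F3}" "F1 \<noteq> F2" "F2 \<noteq> F3" "F3 \<noteq> F1"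
      by (rule simple_3_polytope_incidence[OF P v0])
    have "count {#num_edges F1, num_edges F2, num_edges F3#} 5 \<le> 1"
      using one5 unfolding count_ell[OF A] .
    moreover have "F \<in> {F1, F2, F3}" "F' \<in> {F1, F2, F3}" using F A(1) by blast+
    ultimately show False using 5 F(5) by (elim insertE emptyE) (simp_all split: if_splits)
  qed
  \<comment> \<open>Truncation adds at most one edge, and only to faces at \<open>v\<^sub>0\<close>,
    so a hexagon can come only from a pentagon there.\<close>
  have num_L: "num_edges (F \<inter> L) \<le> 6" "num_edges (F \<inter> L) > 5 \<Longrightarrow> num_edges F = 5 \<and> v\<^sub>0 \<in> F"
    if "v \<in> vertices P" "F \<in> two_faces P" "v \<in> F" for v F
    using le5[OF that] num_edges_truncated_face[OF that(2)] by (auto split: if_splits)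
  have pos: "resistance_curvature (vertices Q) (adjacent Q) x > 0" if xQ: "x \<in> vertices Q" for x
  proof -
    from xQ have "x \<in> vertices (P \<inter> L)" by (simp add: Q)
    then show ?thesis
    proof (cases rule: vertex_of_truncation_cases)
      case old
      have deg: "card {e. e edge_of Q \<and> x \<in> e} \<le> 3"
        unfolding Q using old_vertex_degree[OF old(2)] simple_3_polytope_degree[OF P old(1)] by simp
      have from_P: "\<exists>F. F \<in> two_faces P \<and> x \<in> F \<and> G = F \<inter> L" if "G \<in> two_faces Q" "x \<in> G" for G
        using that(1) unfolding Q
        by (cases rule: two_face_of_truncation_cases[OF dim]) (use that(2) old(2) in auto)
      \<comment> \<open>Otherwise each 2-face of \<open>P\<close> at x is a pentagon, or has four or
        five edges and passes through \<open>v\<^sub>0\<close>. The remaining work shows that at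
        most one passes through \<open>v\<^sub>0\<close>, which leaves only the excluded types
        (5,5,5) and (5,5,4).\<close>
      have four: "\<exists>F\<in>two_faces Q. x \<in> F \<and> num_edges F \<le> 4"
      proof (rule ccontr)
        assume no: "\<not> ?thesis"
        have big: "num_edges (F \<inter> L) > 4" if "F \<in> two_faces P" "x \<in> F" for F
          using no two_face_truncation[OF that(1)] that(2) old(2) unfolding Q by force
        have out: "num_edges F = 5" if "F \<in> two_faces P" "x \<in> F" "v\<^sub>0 \<notin> F" for F
          using big[OF that(1,2)] num_edges_truncated_face[OF that(1)] that(3) le5[OF old(1) that(1,2)] by auto
        have inn: "num_edges F \<in> {4, 5}" if "F \<in> two_faces P" "x \<in> F" "v\<^sub>0 \<in> F" for F
          using big[OF that(1,2)] num_edges_truncated_face[OF that(1)] that(3) le5[OF old(1) that(1,2)] by auto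
        obtain e1 e2 e3 F1 F2 F3 where
          E: "{e. e edge_of P \<and> x \<in> e} = {e1, e2, e3}" "e1 \<noteq> e2" "e2 \<noteq> e3" "e3 \<noteq> e1" and
          A: "{F \<in> two_faces P. x \<in> F} = {F1, F2, F3}" "F1 \<noteq> F2" "F2 \<noteq> F3" "F3 \<noteq> F1" and
          I: "F2 \<inter> F3 = e1" "F3 \<inter> F1 = e2" "F1 \<inter> F2 = e3"
          using simple_3_polytope_incidence[OF P old(1)] .
        have F: "F1 \<in> two_faces P" "x \<in> F1" "F2 \<in> two_faces P" "x \<in> F2" "F3 \<in> two_faces P" "x \<in> F3"
          using A(1) by blast+
        have e: "e1 edge_of P" "x \<in> e1" "e2 edge_of P" "x \<in> e2" "e3 edge_of P" "x \<in> e3"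
          using E(1) by blast+
        have "x \<noteq> v\<^sub>0" using old(2) above by auto
        have seg: "e' = closed_segment x v\<^sub>0" if "e' edge_of P" "x \<in> e'" "v\<^sub>0 \<in> e'" for e'
          using edge_eq_segment[OF poly that(1) old(1) that(2) v0 that(3) \<open>x \<noteq> v\<^sub>0\<close>] .
        \<comment> \<open>If two of the faces contain \<open>v\<^sub>0\<close>, their common edge
          joins x to \<open>v\<^sub>0\<close>. The third face is then opposite to
          \<open>v\<^sub>0\<close> and has at most four edges by \<open>opposite\<close>, whereas
          \<open>out\<close> gives it five.\<close>
        have third: "v\<^sub>0 \<notin> F \<inter> F'"
          if "F \<in> {F1, F2, F3}" "F' \<in> {F1, F2, F3}" "F \<noteq> F'" for F F'
        proof
          assume v: "v\<^sub>0 \<in> F \<inter> F'"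
          have "F \<inter> F' \<in> {e1, e2, e3}" using that I by blast
          then have "F \<inter> F' edge_of P" "x \<in> F \<inter> F'" using e by blast+
          then have "adjacent P x v\<^sub>0" using seg v by (metis adjacent_def)
          moreover obtain F'' where F'': "F'' \<in> {F1, F2, F3}" "F'' \<noteq> F" "F'' \<noteq> F'"
            using that A(2-4) by blast
          have "F'' \<in> two_faces P" "x \<in> F''" using F F'' by blast+
          \<comment> \<open>With \<open>v\<^sub>0\<close> on all three faces, two different edges at
            x would both be the segment to \<open>v\<^sub>0\<close>.\<close>
          moreover have "v\<^sub>0 \<notin> F''"
          proof
            assume "v\<^sub>0 \<in> F''"
            then have "v\<^sub>0 \<in> F1 \<and> v\<^sub>0 \<in> F2 \<and> v\<^sub>0 \<in> F3" using v F'' that A(2-4) by blast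
            then have "v\<^sub>0 \<in> e1" "v\<^sub>0 \<in> e2" using I by blast+
            then have "e1 = e2" using seg e by metis
            then show False using E by blast
          qed
          ultimately have "num_edges F'' \<le> 4" "num_edges F'' = 5" using opposite old(1) out by blast+
          then show False by simp
        qed
        have ell: "ell P x = rev (sorted_list_of_multiset {#num_edges F1, num_edges F2, num_edges F3#})"
          by (rule ell_eq[OF A])
        have "ell P x = [5, 5, 5] \<or> (ell P x = [5, 5, 4] \<and> (\<exists>F\<in>two_faces P. v\<^sub>0 \<in> F \<and> x \<in> F))"
        proof (cases "v\<^sub>0 \<in> F1")
          case True
          then have "v\<^sub>0 \<notin> F2" "v\<^sub>0 \<notin> F3" using third[of F1 F2] third[of F1 F3] A(2-4) by blast+
          then have "num_edges F2 = 5" "num_edges F3 = 5" using F out by blast+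
          then show ?thesis using inn[OF F(1,2) True] True F unfolding ell by auto
        next
          case F1: False
          show ?thesis
          proof (cases "v\<^sub>0 \<in> F2")
            case True
            then have "v\<^sub>0 \<notin> F3" using third[of F2 F3] A(2-4) by blast
            then have "num_edges F1 = 5" "num_edges F3 = 5" using F F1 out by blast+
            then show ?thesis using inn[OF F(3,4) True] True F unfolding ell by auto
          next
            case False
            then have 5: "num_edges F1 = 5" "num_edges F2 = 5" using F F1 out by blast+
            show ?thesis
            proof (cases "v\<^sub>0 \<in> F3")
              case True
              show ?thesis using inn[OF F(5,6) True] 5 True F unfolding ell by auto
            next
              case False
              then have "num_edges F3 = 5" using F out by blast
              then show ?thesis using 5 unfolding ell by simp
            qed
          qed
        qed
        then show False using no555 no554 old(1) by blast
      qed
      show ?thesis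
      proof (rule resistance_curvature_pos[OF polyQ dimQ xQ deg _ _ four])
        fix G assume "G \<in> two_faces Q" "x \<in> G"
        then show "num_edges G \<le> 6" using from_P num_L(1)[OF old(1)] by blast
      next
        fix G G' assume G: "G \<in> two_faces Q" "x \<in> G" "G' \<in> two_faces Q" "x \<in> G'" "G \<noteq> G'"
        obtain F F' where F: "F \<in> two_faces P" "x \<in> F" "G = F \<inter> L" "F' \<in> two_faces P" "x \<in> F'" "G' = F' \<inter> L"
          using from_P G by meson
        then have "F \<noteq> F'" using G by blast
        show "num_edges G \<le> 5 \<or> num_edges G' \<le> 5"
        proof (rule ccontr)
          assume "\<not> ?thesis"
          \<comment> \<open>Two hexagons at x would come from two pentagons at
            \<open>v\<^sub>0\<close>.\<close>
          then have "num_edges F = 5 \<and> v\<^sub>0 \<in> F" "num_edges F' = 5 \<and> v\<^sub>0 \<in> F'"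
            using num_L(2)[OF old(1)] F by auto
          then show False using not_both_5[of F F'] F \<open>F \<noteq> F'\<close> by auto
        qed
      qed
    next
      case (new e)
      have xe: "x \<in> e" "a \<bullet> x = b" using new(3) by auto
      obtain e1 e2 e3 F1 F2 F3 where
        E: "{e. e edge_of P \<and> v\<^sub>0 \<in> e} = {e1, e2, e3}" "e1 \<noteq> e2" "e2 \<noteq> e3" "e3 \<noteq> e1" and
        A: "{F \<in> two_faces P. v\<^sub>0 \<in> F} = {F1, F2, F3}" "F1 \<noteq> F2" "F2 \<noteq> F3" "F3 \<noteq> F1" and
        I: "F2 \<inter> F3 = e1" "F3 \<inter> F1 = e2" "F1 \<inter> F2 = e3"
        using simple_3_polytope_incidence[OF P v0] .
      have edge_antisym: "e' = e''" if e: "e' edge_of P" "e'' edge_of P" and sub: "e' \<subseteq> e''" for e' e''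
      proof -
        have "e' face_of e''" using e sub by (auto simp: edge_of_def face_of_face)
        then show ?thesis
          using face_of_aff_dim_lt[of e'' e'] e face_of_imp_convex by (fastforce simp: edge_of_def)
      qed
      \<comment> \<open>If all three 2-faces at \<open>v\<^sub>0\<close> contained \<open>e\<close>,
        it would lie in, and so equal, two different edges.\<close>
      have sub_two: "\<exists>F F'. {F \<in> two_faces P. e \<subseteq> F} \<subseteq> {F, F'}"
      proof -
        have e_cases: "e = e1 \<or> e = e2 \<or> e = e3" using new E(1) by blast
        have edges: "e1 edge_of P" "e2 edge_of P" "e3 edge_of P" using E(1) by blast+
        have faces: "{F \<in> two_faces P. e \<subseteq> F} \<subseteq> {F1, F2, F3}" using A(1) new(2) by blast
        have "\<not> (e \<subseteq> F1 \<and> e \<subseteq> F2 \<and> e \<subseteq> F3)"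
        proof
          assume "e \<subseteq> F1 \<and> e \<subseteq> F2 \<and> e \<subseteq> F3"
          then have "e \<subseteq> e1" "e \<subseteq> e2" using I by blast+
          then have "e = e1" "e = e2" using edge_antisym[OF new(1)] edges by blast+
          then show False using E by blast
        qed
        then show ?thesis using faces by blast
      qed
      have deg: "card {e. e edge_of Q \<and> x \<in> e} \<le> 3"
      proof -
        obtain F F' where sub: "{F \<in> two_faces P. e \<subseteq> F} \<subseteq> {F, F'}" using sub_two by blast
        have "card {F \<in> two_faces P. e \<subseteq> F} \<le> card {F, F'}" using sub by (intro card_mono) auto
        also have "\<dots> \<le> 2" by (simp add: card_insert_if)
        finally show ?thesis unfolding Q using new_vertex_degree[OF new] by simp
      qed
      have T: "num_edges (P \<inter> H) = 3"
        unfolding num_edges_slice A(1) using A(2-4) by simp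
      \<comment> \<open>The 2-faces at a new vertex are the new triangle and truncated faces through
        \<open>v\<^sub>0\<close>. The triangle supplies the face with at most four edges, and
        \<open>not_both_5\<close> excludes two hexagons.\<close>
      have from_P: "G = P \<inter> H \<or> (\<exists>F. F \<in> two_faces P \<and> v\<^sub>0 \<in> F \<and> G = F \<inter> L)"
        if "G \<in> two_faces Q" "x \<in> G" for G
      proof -
        have "G \<in> two_faces (P \<inter> L)" using that(1) by (simp only: Q)
        with dim show ?thesis
        proof (cases rule: two_face_of_truncation_cases)
          case (halfspace F)
          then have "e \<subseteq> F" using that(2) by (intro edge_subset_of_meets[OF new]) (auto simp: two_faces_def)
          then show ?thesis using halfspace new(2) by blast
        qed simp
      qed
      have four: "\<exists>F\<in>two_faces Q. x \<in> F \<and> num_edges F \<le> 4"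
      proof (rule bexI[of _ "P \<inter> H"])
        have "x \<in> P" using xe new(1) face_of_imp_subset unfolding edge_of_def by blast
        then show "x \<in> P \<inter> H \<and> num_edges (P \<inter> H) \<le> 4" using T xe by simp
        show "P \<inter> H \<in> two_faces Q" unfolding Q by (rule slice_two_face[OF dim])
      qed
      show ?thesis
      proof (rule resistance_curvature_pos[OF polyQ dimQ xQ deg _ _ four])
        fix G assume "G \<in> two_faces Q" "x \<in> G"
        then show "num_edges G \<le> 6" using from_P num_L(1)[OF v0] T by fastforce
      next
        fix G G' assume G: "G \<in> two_faces Q" "x \<in> G" "G' \<in> two_faces Q" "x \<in> G'" "G \<noteq> G'"
        show "num_edges G \<le> 5 \<or> num_edges G' \<le> 5"
        proof (rule ccontr)
          assume no: "\<not> ?thesis"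
          then have "G \<noteq> P \<inter> H" "G' \<noteq> P \<inter> H" using T by auto
          then obtain F F' where F: "F \<in> two_faces P" "v\<^sub>0 \<in> F" "G = F \<inter> L" "F' \<in> two_faces P" "v\<^sub>0 \<in> F'" "G' = F' \<inter> L"
            using from_P G by meson
          then have "F \<noteq> F'" using G by blast
          have "num_edges F = 5" "num_edges F' = 5"
            using num_L(2)[OF v0] F no by auto
          then show False using not_both_5[of F F'] F \<open>F \<noteq> F'\<close> by auto
        qed
      qed
    qed
  qed
  then show ?thesis by (simp add: resistance_positive_def)
qed

end
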